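(* Let $M$ be a smooth, non-compact, boundaryless, connected manifold. If $\#(\mathscr{E}(M))\ge 3$, then for any complete Riemannian metric $g$ on $M$, the associated Hamilton–Jacobi equation $|\nabla u|_g=1$ admits no $C^1$ solution on $M$.
   Context: $\#$ denotes cardinality. $\nabla$ and $|\cdot|_g$ denote the gradient and norm of the metric $g$. A $C^1$ solution is a $C^1$ function $u:M\to\mathbb{R}$ with $|\nabla u(x)|_g=1$ for all $x\in M$. $\mathscr{E}(M)$ is the set of (Freudenthal, topological) ends of $M$; it does not depend on the Riemannian metric. For a complete Riemannian metric on $M$ with distance $d$ it can be described as follows. A ray is a unit-speed geodesic $\gamma:[0,+\infty)\to M$ with $d(\gamma(t_1),\gamma(t_2))=|t_2-t_1|$ for all $t_1,t_2\ge0$. Two rays $\gamma_1,\gamma_2$ are cofinal if for every compact $K\subseteq M$ there is $t_K>0$ such that $\gamma_1(t_1)$ and $\gamma_2(t_2)$ lie in the same connected component of $M\setminus K$ for all $t_1,t_2\ge t_K$. An end of $M$ is an equivalence class of cofinal rays. *)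

theory Defs
  imports "HOL-Analysis.Analysis"
begin

text \<open>Only meant for open \<open>S\<close>: the derivatives are taken at \<open>at x\<close>, not within \<open>S\<close>.\<close>

fun Ck_on :: "nat \<Rightarrow> 'b::real_normed_vector set \<Rightarrow> ('b \<Rightarrow> 'c::real_normed_vector) \<Rightarrow> bool" where
  "Ck_on 0 S f \<longleftrightarrow> continuous_on S f"
| "Ck_on (Suc k) S f \<longleftrightarrow> (\<forall>x\<in>S. f differentiable (at x)) \<and>
     (\<forall>v. Ck_on k S (\<lambda>x. frechet_derivative f (at x) v))"

definition Csmooth_on :: "'b::real_normed_vector set \<Rightarrow> ('b \<Rightarrow> 'c::real_normed_vector) \<Rightarrow> bool" where
  "Csmooth_on S f \<longleftrightarrow> (\<forall>k. Ck_on k S f)"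

text \<open>A chart is a pair of its domain and its coordinate map; the values of the coordinate map
  outside the domain are irrelevant.\<close>

type_synonym ('a, 'b) chart = "'a set \<times> ('a \<Rightarrow> 'b)"

definition chart_range :: "('a, 'b) chart \<Rightarrow> 'b set" where
  "chart_range c = snd c ` fst c"

definition chart_inv :: "('a, 'b) chart \<Rightarrow> 'b \<Rightarrow> 'a" where
  "chart_inv c = inv_into (fst c) (snd c)"

definition transition :: "('a, 'b) chart \<Rightarrow> ('a, 'b) chart \<Rightarrow> 'b \<Rightarrow> 'b" where
  "transition c c' = snd c' \<circ> chart_inv c"

text \<open>The smooth structure is the one generated by the atlas \<open>A\<close>, which need not be maximal. The
  notions below that are tested on all charts of \<open>A\<close> depend only on this structure.
  The dimension of the manifold is \<open>DIM('b)\<close>.\<close>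

locale smooth_manifold =
  fixes X :: "'a topology" and A :: "('a, 'b::euclidean_space) chart set"
  assumes Hausdorff: "Hausdorff_space X"
    and second_countable: "second_countable X"
    and charts_cover: "(\<Union>c\<in>A. fst c) = topspace X"
    and chart_domain_open: "c \<in> A \<Longrightarrow> openin X (fst c)"
    and chart_range_open: "c \<in> A \<Longrightarrow> open (chart_range c)"
    and chart_homeomorphic: "c \<in> A \<Longrightarrow>
          homeomorphic_map (subtopology X (fst c)) (top_of_set (chart_range c)) (snd c)"
    and transition_smooth: "c \<in> A \<Longrightarrow> c' \<in> A \<Longrightarrow>
          Csmooth_on (snd c ` (fst c \<inter> fst c')) (transition c c')"

text \<open>The Freudenthal ends, as the inverse limit of the connected components of \<open>X - K\<close> over the
  compact sets \<open>K\<close> directed by inclusion. An end is a compatible choice of components;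
  compatibility forces each chosen component not to be relatively compact.\<close>

definition ends_of :: "'a topology \<Rightarrow> ('a set \<Rightarrow> 'a set) set" where
  "ends_of X = {e \<in> (\<Pi>\<^sub>E K\<in>{K. compactin X K}.
                       connected_components_of (subtopology X (topspace X - K))).
                 \<forall>K L. compactin X K \<and> compactin X L \<and> K \<subseteq> L \<longrightarrow> e L \<subseteq> e K}"

text \<open>A tangent vector at \<open>p\<close> is represented in a chart \<open>c\<close> around \<open>p\<close> by its vector of components
  in \<open>'b\<close>, and a Riemannian metric by its coordinate expressions: \<open>g c p v w\<close> is the inner product
  of the tangent vectors at \<open>p\<close> whose components in the chart \<open>c\<close> are \<open>v\<close> and \<open>w\<close>.\<close>

type_synonym ('a, 'b) metric_tensor = "('a, 'b) chart \<Rightarrow> 'a \<Rightarrow> 'b \<Rightarrow> 'b \<Rightarrow> real"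

definition riemannian_metric ::
  "('a, 'b::euclidean_space) chart set \<Rightarrow> ('a, 'b) metric_tensor \<Rightarrow> bool" where
  "riemannian_metric A g \<longleftrightarrow>
     (\<forall>c\<in>A. \<forall>p\<in>fst c. bilinear (g c p) \<and> (\<forall>v w. g c p v w = g c p w v) \<and>
        (\<forall>v. v \<noteq> 0 \<longrightarrow> g c p v v > 0)) \<and>
     (\<forall>c\<in>A. \<forall>v w. Csmooth_on (chart_range c) (\<lambda>x. g c (chart_inv c x) v w)) \<and>
     (\<forall>c\<in>A. \<forall>c'\<in>A. \<forall>p\<in>fst c \<inter> fst c'. \<forall>v w.
        g c p v w = g c' p (frechet_derivative (transition c c') (at (snd c p)) v)
                           (frechet_derivative (transition c c') (at (snd c p)) w))"

definition riem_norm :: "('a, 'b) metric_tensor \<Rightarrow> ('a, 'b) chart \<Rightarrow> 'a \<Rightarrow> 'b \<Rightarrow> real" where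
  "riem_norm g c p v = sqrt (g c p v v)"

text \<open>\<open>C\<^sup>1\<close> up to the end points of \<open>[a, b]\<close>, with one-sided derivatives there.\<close>

definition C1_curve_on :: "'a topology \<Rightarrow> ('a, 'b::euclidean_space) chart set \<Rightarrow>
    real \<Rightarrow> real \<Rightarrow> (real \<Rightarrow> 'a) \<Rightarrow> bool" where
  "C1_curve_on X A a b \<gamma> \<longleftrightarrow> continuous_map (top_of_set {a..b}) X \<gamma> \<and>
     (\<forall>c\<in>A. \<exists>D. continuous_on {t \<in> {a..b}. \<gamma> t \<in> fst c} D \<and>
        (\<forall>t\<in>{a..b}. \<gamma> t \<in> fst c \<longrightarrow>
           ((snd c \<circ> \<gamma>) has_vector_derivative D t) (at t within {a..b})))"

definition piecewise_C1_curve :: "'a topology \<Rightarrow> ('a, 'b::euclidean_space) chart set \<Rightarrow>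
    (real \<Rightarrow> 'a) \<Rightarrow> bool" where
  "piecewise_C1_curve X A \<gamma> \<longleftrightarrow> (\<exists>(n::nat) s. s 0 = 0 \<and> s n = 1 \<and>
     (\<forall>i<n. s i < s (Suc i) \<and> C1_curve_on X A (s i) (s (Suc i)) \<gamma>))"

text \<open>By the transformation law of \<open>g\<close> the speed does not depend on the chosen chart.\<close>

definition curve_speed :: "('a, 'b::euclidean_space) chart set \<Rightarrow> ('a, 'b) metric_tensor \<Rightarrow>
    (real \<Rightarrow> 'a) \<Rightarrow> real \<Rightarrow> real" where
  "curve_speed A g \<gamma> t = (let c = (SOME c. c \<in> A \<and> \<gamma> t \<in> fst c) in
     riem_norm g c (\<gamma> t) (vector_derivative (snd c \<circ> \<gamma>) (at t)))"

text \<open>The speed is meaningless at the finitely many break points (and at \<open>0\<close> and \<open>1\<close>), which do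
  not affect the integral.\<close>

definition curve_length :: "('a, 'b::euclidean_space) chart set \<Rightarrow> ('a, 'b) metric_tensor \<Rightarrow>
    (real \<Rightarrow> 'a) \<Rightarrow> real" where
  "curve_length A g \<gamma> = integral {0..1} (curve_speed A g \<gamma>)"

text \<open>On a connected manifold the set of curves is nonempty for \<open>p\<close>, \<open>q\<close> in \<open>topspace X\<close>. The value
  \<open>0\<close> off \<open>topspace X\<close> is there because \<open>Metric_space\<close> demands nonnegativity and symmetry on the
  whole type.\<close>

definition riem_dist :: "'a topology \<Rightarrow> ('a, 'b::euclidean_space) chart set \<Rightarrow>
    ('a, 'b) metric_tensor \<Rightarrow> 'a \<Rightarrow> 'a \<Rightarrow> real" where
  "riem_dist X A g p q =
     (if p \<in> topspace X \<and> q \<in> topspace X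
      then Inf {curve_length A g \<gamma> |\<gamma>. piecewise_C1_curve X A \<gamma> \<and> \<gamma> 0 = p \<and> \<gamma> 1 = q}
      else 0)"

definition complete_riemannian_metric :: "'a topology \<Rightarrow> ('a, 'b::euclidean_space) chart set \<Rightarrow>
    ('a, 'b) metric_tensor \<Rightarrow> bool" where
  "complete_riemannian_metric X A g \<longleftrightarrow> riemannian_metric A g \<and>
     Metric_space.mcomplete (topspace X) (riem_dist X A g)"

definition C1_function :: "('a, 'b::euclidean_space) chart set \<Rightarrow> ('a \<Rightarrow> real) \<Rightarrow> bool" where
  "C1_function A u \<longleftrightarrow> (\<forall>c\<in>A. Ck_on 1 (chart_range c) (u \<circ> chart_inv c))"

text \<open>The components in the chart \<open>c\<close> of the vector dual to \<open>du\<close> with respect to \<open>g\<close>.\<close>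

definition riem_gradient :: "('a, 'b::euclidean_space) metric_tensor \<Rightarrow> ('a, 'b) chart \<Rightarrow>
    ('a \<Rightarrow> real) \<Rightarrow> 'a \<Rightarrow> 'b" where
  "riem_gradient g c u p =
     (THE w. \<forall>v. g c p w v = frechet_derivative (u \<circ> chart_inv c) (at (snd c p)) v)"

definition C1_eikonal_solution :: "('a, 'b::euclidean_space) chart set \<Rightarrow>
    ('a, 'b) metric_tensor \<Rightarrow> ('a \<Rightarrow> real) \<Rightarrow> bool" where
  "C1_eikonal_solution A g u \<longleftrightarrow> C1_function A u \<and>
     (\<forall>c\<in>A. \<forall>p\<in>fst c. riem_norm g c p (riem_gradient g c u p) = 1)"

end

theory Submission
  imports Defs
begin

text \<open>
  A solution \<open>u\<close> has no critical points, and one can follow its gradient upwards to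
  any height. Hence \<open>{u > a}\<close> is connected for every \<open>a\<close>: a path between two of its points, taken
  anywhere in the manifold, can be pushed up until it lies in \<open>{u > a}\<close>. The same holds for \<open>{u < -a}\<close>, because \<open>-u\<close> is again a solution. If \<open>K\<close> is compact
  and \<open>\<bar>u\<bar> \<le> a\<close> on \<open>K\<close>, both sets miss \<open>K\<close>, so each lies in a single component of the complement
  of \<open>K\<close>. Every component of the complement that belongs to an end contains one of them: starting
  from a point far from \<open>K\<close> one climbs above \<open>a\<close> before \<open>K\<close> can be reached. Three ends would be
  separated by some \<open>K\<close> into three components, and there are only two sets to share among them.

  The gradient of a \<open>C\<^sup>1\<close> function is merely continuous, so a priori it does not generate a flow.
  The flow is therefore replaced by maps that move points inside one chart ball along a constant direction
  close to the gradient. What replaces the flow lines is the relation \<open>climbs\<close>: \<open>y\<close> is reached from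
  \<open>x\<close> along a connected set on which the distance from \<open>x\<close> is at most \<open>C\<close> times the gain of \<open>u\<close>. It
  is transitive, so maps that push every point up in this sense (\<open>pushes\<close>) may be composed freely.
  A point that has not yet gained a given height remains in a bounded region, which is compact by the
  theorem of Hopf and Rinow (this is where completeness enters); there finitely many chart
  balls give a uniform gain per round, and finitely many rounds suffice.

  The argument up to the bound on the number of ends (\<open>at_most_two_ends\<close>) takes place in a metric
  space. The rest shows that its hypotheses hold on a manifold: the infimum of curve lengths is a
  metric with the manifold topology and approximate midpoints, bounded below by an estimate
  through a \<open>C\<^sup>1\<close> bump function and above by coordinate segments; and \<open>|\<nabla>u| = 1\<close> yields the local
  pushing maps (\<open>unit_ascent_locally_pushable\<close>).
\<close>

section \<open>The theorem of Hopf and Rinow\<close>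

context Metric_space
begin

text \<open>Points that divide the distance approximately in any given proportion. This weak form of the
  existence of shortest curves can be read off from a distance defined as an infimum of lengths.\<close>

definition length_property :: bool where
  "length_property \<longleftrightarrow> (\<forall>x\<in>M. \<forall>y\<in>M. \<forall>r>0. \<forall>s>0.
     d x y < r + s \<longrightarrow> (\<exists>z\<in>M. d x z < r \<and> d z y < s))"

definition locally_compact_metric :: bool where
  "locally_compact_metric \<longleftrightarrow> (\<forall>x\<in>M. \<exists>r>0. compactin mtopology (mcball x r))"

text \<open>The closed ball of radius \<open>R\<close> is totally bounded, because each of its points is, by the length
  property, within \<open>2 * \<delta>\<close> of the compact ball of radius \<open>R - \<delta>\<close>.\<close>

lemma compactin_mcball_limit:
  assumes "mcomplete" "length_property" "p \<in> M" "R > 0"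
    and small: "\<And>r. 0 < r \<Longrightarrow> r < R \<Longrightarrow> compactin mtopology (mcball p r)"
  shows "compactin mtopology (mcball p R)"
proof -
  have tb: "mtotally_bounded (mcball p R)"
    unfolding mtotally_bounded_def
  proof (intro allI impI)
    fix e :: real assume e: "e > 0"
    define \<delta> where "\<delta> = min (e / 6) (R / 2)"
    have \<delta>: "\<delta> > 0" "\<delta> < R" "6 * \<delta> \<le> e"
      using e \<open>R > 0\<close> by (auto simp: \<delta>_def min_def)
    have "mtotally_bounded (mcball p (R - \<delta>))"
      using small[of "R - \<delta>"] \<delta> compactin_imp_mtotally_bounded by auto
    then obtain F where F: "finite F" "F \<subseteq> mcball p (R - \<delta>)"
        "mcball p (R - \<delta>) \<subseteq> (\<Union>x\<in>F. mball x \<delta>)"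
      using \<delta>(1) unfolding mtotally_bounded_def by meson
    have "mcball p R \<subseteq> (\<Union>x\<in>F. mball x e)"
    proof
      fix q assume q: "q \<in> mcball p R"
      then have "d p q < (R - \<delta>) + 2 * \<delta>" using \<delta> by auto
      then obtain z where z: "z \<in> M" "d p z < R - \<delta>" "d z q < 2 * \<delta>"
        using \<open>length_property\<close> \<delta> q unfolding length_property_def
        by (metis diff_gt_0_iff_gt in_mcball mult_pos_pos zero_less_numeral)
      then obtain x where x: "x \<in> F" "d x z < \<delta>" "x \<in> M"
        using F(3) \<open>p \<in> M\<close> by fastforce
      then have "d x q < e"
        using triangle[of x z q] z q \<delta> by auto
      then show "q \<in> (\<Union>x\<in>F. mball x e)" using x q by auto
    qed
    moreover have "F \<subseteq> mcball p R" using F(2) \<delta> by fastforce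
    ultimately show "\<exists>K. finite K \<and> K \<subseteq> mcball p R \<and> mcball p R \<subseteq> (\<Union>x\<in>K. mball x e)"
      using F(1) by blast
  qed
  interpret S: Submetric M d "mcball p R"
    by unfold_locales auto
  have "S.sub.mcomplete"
    using S.closedin_eq_mcomplete[OF \<open>mcomplete\<close>] by simp
  moreover have "S.sub.mtotally_bounded (mcball p R)"
    using tb mtotally_bounded_absolute by blast
  ultimately have "compact_space S.sub.mtopology"
    using S.sub.compact_space_eq_mcomplete_mtotally_bounded by simp
  then show ?thesis
    by (simp add: compactin_subspace S.mtopology_submetric mcball_subset_mspace)
qed

text \<open>Finitely many compact balls cover a compact ball \<open>mcball p R\<close> with room to spare, and by the length
  property every point at distance slightly more than \<open>R\<close> from \<open>p\<close> is close to \<open>mcball p R\<close>.\<close>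

lemma compactin_mcball_extend:
  assumes "locally_compact_metric" "length_property" "p \<in> M" "R > 0"
    and cpt: "compactin mtopology (mcball p R)"
  shows "\<exists>R'>R. compactin mtopology (mcball p R')"
proof -
  obtain r where r: "\<And>x. x \<in> M \<Longrightarrow> r x > 0 \<and> compactin mtopology (mcball x (r x))"
    using assms(1) unfolding locally_compact_metric_def by metis
  obtain \<F> where fin: "finite \<F>" and sub: "\<F> \<subseteq> (\<lambda>x. mball x (r x / 2)) ` mcball p R"
      and cov: "mcball p R \<subseteq> \<Union>\<F>"
  proof -
    have "mcball p R \<subseteq> \<Union>((\<lambda>x. mball x (r x / 2)) ` mcball p R)"
    proof
      fix x assume "x \<in> mcball p R"
      moreover from this have "x \<in> mball x (r x / 2)" using r[of x] by simp
      ultimately show "x \<in> \<Union>((\<lambda>x. mball x (r x / 2)) ` mcball p R)" by blast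
    qed
    then show ?thesis using that compactinD[OF cpt, of "(\<lambda>x. mball x (r x / 2)) ` mcball p R"] by blast
  qed
  obtain F where F: "F \<subseteq> mcball p R" "finite F" "\<F> = (\<lambda>x. mball x (r x / 2)) ` F"
    using finite_subset_image[OF fin sub] by blast
  have F: "finite F" "F \<subseteq> mcball p R" "mcball p R \<subseteq> (\<Union>x\<in>F. mball x (r x / 2))"
    using F cov by auto
  have "F \<noteq> {}" using F(3) \<open>p \<in> M\<close> \<open>R > 0\<close> centre_in_mcball_iff[of p R] by fastforce
  define \<delta> where "\<delta> = Min ((\<lambda>x. r x / 2) ` F)"
  have \<delta>: "\<delta> > 0"
    using F r \<open>F \<noteq> {}\<close> by (auto simp: \<delta>_def subset_eq)
  have \<delta>_le: "\<delta> \<le> r x / 2" if "x \<in> F" for x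
    using F that unfolding \<delta>_def by (intro Min_le) auto
  have "mcball p (R + \<delta> / 2) \<subseteq> (\<Union>x\<in>F. mcball x (r x))"
  proof
    fix q assume q: "q \<in> mcball p (R + \<delta> / 2)"
    then have "d p q < R + \<delta>" using \<delta> by auto
    then obtain z where z: "z \<in> M" "d p z < R" "d z q < \<delta>"
      using \<open>length_property\<close> \<delta> q \<open>R > 0\<close> unfolding length_property_def by (metis in_mcball)
    then obtain x where x: "x \<in> F" "d x z < r x / 2" "x \<in> M"
      using F(3) \<open>p \<in> M\<close> by fastforce
    then have "d x q \<le> r x"
      using triangle[of x z q] z q \<delta>_le[OF x(1)] by auto
    then show "q \<in> (\<Union>x\<in>F. mcball x (r x))" using x q by auto
  qed
  moreover have "compactin mtopology (\<Union>x\<in>F. mcball x (r x))"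
    using F r by (intro compactin_Union) auto
  ultimately have "compactin mtopology (mcball p (R + \<delta> / 2))"
    using closed_compactin closedin_mcball by blast
  then show ?thesis using \<delta>(1) by (intro exI[of _ "R + \<delta> / 2"]) auto
qed

text \<open>The set of radii with compact ball is closed under increasing limits and has no largest
  element, by the two preceding lemmas.\<close>

theorem Hopf_Rinow_compactin_mcball:
  assumes "mcomplete" "locally_compact_metric" "length_property" "p \<in> M"
  shows "compactin mtopology (mcball p R)"
proof -
  have mono: "compactin mtopology (mcball p r)"
    if "r \<le> s" "compactin mtopology (mcball p s)" for r s
    using that closed_compactin closedin_mcball mcball_subset_concentric by metis
  define B where "B = {r. r > 0 \<and> \<not> compactin mtopology (mcball p r)}"
  obtain r0 where r0: "r0 > 0" "compactin mtopology (mcball p r0)"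
    using assms(2,4) unfolding locally_compact_metric_def by meson
  have "B = {}"
  proof (rule ccontr)
    assume "B \<noteq> {}"
    have lb: "r0 \<le> r" if "r \<in> B" for r
      using that mono[of r r0] r0 unfolding B_def by fastforce
    then have bdd: "bdd_below B" by (auto simp: bdd_below_def)
    have "r0 \<le> Inf B" using \<open>B \<noteq> {}\<close> lb by (intro cInf_greatest)
    then have pos: "Inf B > 0" using r0 by auto
    have "compactin mtopology (mcball p (Inf B))"
    proof (rule compactin_mcball_limit[OF assms(1,3,4) pos])
      fix r assume "0 < r" "r < Inf B"
      then show "compactin mtopology (mcball p r)"
        using cInf_lower[OF _ bdd, of r] unfolding B_def by fastforce
    qed
    then obtain R' where R': "R' > Inf B" "compactin mtopology (mcball p R')"
      using compactin_mcball_extend[OF assms(2,3,4) pos] by blast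
    then obtain b where "b \<in> B" "b < R'"
      using cInf_lessD[OF \<open>B \<noteq> {}\<close>] by blast
    then show False using mono[of b R'] R' unfolding B_def by auto
  qed
  then have "compactin mtopology (mcball p (max R 1))"
    unfolding B_def by fastforce
  then show ?thesis using mono[of R "max R 1"] by auto
qed

corollary Hopf_Rinow_neighbourhood:
  assumes "mcomplete" "locally_compact_metric" "length_property" "compactin mtopology K"
  shows "\<exists>L. compactin mtopology L \<and> {x \<in> M. \<exists>k\<in>K. d k x \<le> R} \<subseteq> L"
proof (cases "K = {}")
  case True
  then show ?thesis by (intro exI[of _ "{}"]) auto
next
  case False
  then obtain p where p: "p \<in> K" by auto
  have "K \<subseteq> M" using assms(4) compactin_subset_topspace by force
  obtain B where B: "\<And>k. k \<in> K \<Longrightarrow> d p k \<le> B"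
    using compactin_imp_mbounded[OF assms(4)] p unfolding mbounded_alt by blast
  have "{x \<in> M. \<exists>k\<in>K. d k x \<le> R} \<subseteq> mcball p (B + R)"
  proof clarify
    fix x k assume "x \<in> M" "k \<in> K" "d k x \<le> R"
    then show "x \<in> mcball p (B + R)"
      using triangle[of p k x] B[of k] p \<open>K \<subseteq> M\<close> by (auto simp: subset_eq)
  qed
  then show ?thesis
    using Hopf_Rinow_compactin_mcball[OF assms(1-3)] p \<open>K \<subseteq> M\<close> by blast
qed

section \<open>Climbing and pushing maps\<close>

text \<open>A substitute for flow lines of the gradient of \<open>u\<close>. The inequality forces \<open>u\<close> to be at least \<open>u x\<close> on
  \<open>S\<close>, and bounds the distance travelled by the height gained.\<close>

definition climbs :: "('a \<Rightarrow> real) \<Rightarrow> real \<Rightarrow> 'a \<Rightarrow> 'a \<Rightarrow> bool" where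
  "climbs u C x y \<longleftrightarrow> (\<exists>S. connectedin mtopology S \<and> x \<in> S \<and> y \<in> S \<and>
     (\<forall>s\<in>S. d x s \<le> C * (u s - u x)))"

lemma climbs_refl: "x \<in> M \<Longrightarrow> climbs u C x x"
  unfolding climbs_def by (intro exI[of _ "{x}"]) (auto simp: connectedin_sing)

lemma climbs_in_space: "climbs u C x y \<Longrightarrow> x \<in> M \<and> y \<in> M"
  unfolding climbs_def using connectedin_subset_topspace by fastforce

lemma climbs_dist: "climbs u C x y \<Longrightarrow> d x y \<le> C * (u y - u x)"
  unfolding climbs_def by auto

lemma climbs_trans:
  assumes xy: "climbs u C x y" and yz: "climbs u C y z"
  shows "climbs u C x z"
proof -
  obtain S where S: "connectedin mtopology S" "x \<in> S" "y \<in> S" "\<forall>s\<in>S. d x s \<le> C * (u s - u x)"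
    using xy unfolding climbs_def by auto
  obtain T where T: "connectedin mtopology T" "y \<in> T" "z \<in> T" "\<forall>s\<in>T. d y s \<le> C * (u s - u y)"
    using yz unfolding climbs_def by auto
  have "connectedin mtopology (S \<union> T)"
    using S T by (intro connectedin_Un) auto
  moreover have "d x s \<le> C * (u s - u x)" if "s \<in> T" for s
  proof -
    have "s \<in> M" using that T(1) connectedin_subset_topspace by fastforce
    then have "d x s \<le> d x y + d y s"
      using triangle climbs_in_space[OF xy] by blast
    also have "\<dots> \<le> C * (u s - u x)"
      using S T that by (force simp: algebra_simps)
    finally show ?thesis .
  qed
  ultimately show ?thesis using S T unfolding climbs_def by (intro exI[of _ "S \<union> T"]) auto
qed

text \<open>A point that moves at all gains height strictly. This makes compositions of pushing maps harmless:
  one factor cannot spoil the gain of another by moving a point away without raising it.\<close>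

lemma climbs_mono_or_eq:
  assumes "climbs u C x y" "C > 0"
  shows "y = x \<or> u y > u x"
proof -
  have "0 < C * (u y - u x)" if "y \<noteq> x"
  proof -
    have "0 < d x y" using mdist_pos_less[of x y] climbs_in_space[OF assms(1)] that by auto
    then show ?thesis using climbs_dist[OF assms(1)] by linarith
  qed
  then show ?thesis using assms(2) by (metis diff_gt_0_iff_gt zero_less_mult_pos)
qed

lemma climbs_superlevel:
  assumes "climbs u C x y" "C > 0"
  shows "\<exists>S. connectedin mtopology S \<and> x \<in> S \<and> y \<in> S \<and> (\<forall>s\<in>S. u x \<le> u s)"
proof -
  obtain S where S: "connectedin mtopology S" "x \<in> S" "y \<in> S" "\<forall>s\<in>S. d x s \<le> C * (u s - u x)"
    using assms unfolding climbs_def by auto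
  have "u x \<le> u s" if "s \<in> S" for s
  proof -
    have "d x s \<le> C * (u s - u x)" using S that by blast
    then have "0 \<le> C * (u s - u x)" using nonneg[of x s] by linarith
    then show ?thesis using \<open>C > 0\<close> by (simp add: zero_le_mult_iff)
  qed
  then show ?thesis using S by blast
qed

definition pushes :: "('a \<Rightarrow> real) \<Rightarrow> real \<Rightarrow> ('a \<Rightarrow> 'a) \<Rightarrow> bool" where
  "pushes u C \<psi> \<longleftrightarrow> continuous_map mtopology mtopology \<psi> \<and> (\<forall>x\<in>M. climbs u C x (\<psi> x))"

lemma pushes_id: "pushes u C (\<lambda>x. x)"
  by (simp add: pushes_def climbs_refl)

lemma pushes_in_space: "pushes u C \<psi> \<Longrightarrow> x \<in> M \<Longrightarrow> \<psi> x \<in> M"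
  using climbs_in_space unfolding pushes_def by blast

lemma pushes_compose:
  assumes "pushes u C \<phi>" "pushes u C \<psi>"
  shows "pushes u C (\<psi> \<circ> \<phi>)"
  using assms pushes_in_space[OF assms(1)] climbs_trans
  unfolding pushes_def by (auto intro: continuous_map_compose)

lemma pushes_funpow: "pushes u C \<psi> \<Longrightarrow> pushes u C (\<psi> ^^ n)"
  by (induction n) (auto simp: pushes_id id_def pushes_compose)

definition locally_pushable :: "('a \<Rightarrow> real) \<Rightarrow> real \<Rightarrow> bool" where
  "locally_pushable u C \<longleftrightarrow> (\<forall>p\<in>M. \<exists>\<psi>. pushes u C \<psi> \<and> u p < u (\<psi> p))"

text \<open>At a point that some member of the family raises, either an earlier factor of the composition has
  moved the point, and hence raised it already, or the point arrives there unmoved.\<close>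

lemma pushes_finite_combine:
  assumes "C > 0" "finite F" "\<And>\<phi>. \<phi> \<in> F \<Longrightarrow> pushes u C \<phi>"
  shows "\<exists>\<psi>. pushes u C \<psi> \<and> (\<forall>x\<in>M. (\<exists>\<phi>\<in>F. u x < u (\<phi> x)) \<longrightarrow> u x < u (\<psi> x))"
  using assms(2,3)
proof (induction F rule: finite_induct)
  case empty
  then show ?case using pushes_id by auto
next
  case (insert \<phi> F)
  then obtain \<psi> where \<psi>: "pushes u C \<psi>"
      "\<And>x. x \<in> M \<Longrightarrow> (\<exists>\<phi>\<in>F. u x < u (\<phi> x)) \<Longrightarrow> u x < u (\<psi> x)" by auto
  have \<phi>: "pushes u C \<phi>" using insert.prems by auto
  have "u x < u (\<psi> (\<phi> x))" if x: "x \<in> M" and ex: "\<exists>\<phi>\<in>insert \<phi> F. u x < u (\<phi> x)" for x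
  proof -
    have "\<phi> x \<in> M" using pushes_in_space[OF \<phi> x] .
    then have "\<psi> (\<phi> x) = \<phi> x \<or> u (\<phi> x) < u (\<psi> (\<phi> x))"
      using climbs_mono_or_eq \<psi>(1) \<open>C > 0\<close> unfolding pushes_def by blast
    moreover have "\<phi> x = x \<or> u x < u (\<phi> x)"
      using climbs_mono_or_eq \<phi> \<open>C > 0\<close> x unfolding pushes_def by blast
    ultimately show ?thesis using \<psi>(2)[OF x] ex by fastforce
  qed
  then show ?case using pushes_compose[OF \<phi> \<psi>(1)] by (metis comp_apply)
qed

lemma push_gains_on_compact:
  assumes "C > 0" "locally_pushable u C" and contu: "continuous_map mtopology euclideanreal u"
    and K: "compactin mtopology K"
  shows "\<exists>\<psi> e. pushes u C \<psi> \<and> e > 0 \<and> (\<forall>x\<in>K. u x + e \<le> u (\<psi> x))"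
proof -
  obtain \<phi> where \<phi>: "\<And>p. p \<in> M \<Longrightarrow> pushes u C (\<phi> p) \<and> u p < u (\<phi> p p)"
    using assms(2) unfolding locally_pushable_def by metis
  have "K \<subseteq> M" using K compactin_subset_topspace by force
  have contd: "continuous_map mtopology euclideanreal (\<lambda>x. u (\<psi> x) - u x)" if "pushes u C \<psi>" for \<psi>
  proof -
    have "continuous_map mtopology euclideanreal (u \<circ> \<psi>)"
      using that contu unfolding pushes_def by (blast intro: continuous_map_compose)
    then show ?thesis using contu by (auto intro!: continuous_map_diff simp: o_def)
  qed
  define W where "W p = {x \<in> M. 0 < u (\<phi> p x) - u x}" for p
  have openW: "openin mtopology (W p)" if "p \<in> M" for p
    using openin_continuous_map_preimage[OF contd[of "\<phi> p"], of "{0<..}"] \<phi>[OF that]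
    by (auto simp: W_def)
  have "K \<subseteq> \<Union>(W ` K)" using \<phi> \<open>K \<subseteq> M\<close> by (auto simp: W_def subset_eq)
  then obtain \<F> where fin: "finite \<F>" and sub: "\<F> \<subseteq> W ` K" and cov: "K \<subseteq> \<Union>\<F>"
    using compactinD[OF K, of "W ` K"] openW \<open>K \<subseteq> M\<close> by blast
  obtain F where F: "F \<subseteq> K" "finite F" "\<F> = W ` F"
    using finite_subset_image[OF fin sub] by blast
  have F: "finite F" "F \<subseteq> K" "K \<subseteq> (\<Union>p\<in>F. W p)"
    using F cov by auto
  obtain \<psi> where \<psi>: "pushes u C \<psi>"
      "\<And>x. x \<in> M \<Longrightarrow> (\<exists>f\<in>\<phi> ` F. u x < u (f x)) \<Longrightarrow> u x < u (\<psi> x)"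
    proof -
    have "\<And>f. f \<in> \<phi> ` F \<Longrightarrow> pushes u C f" using F \<phi> \<open>K \<subseteq> M\<close> by blast
    then show ?thesis
      using that pushes_finite_combine[OF assms(1) finite_imageI[OF F(1), of \<phi>], of u] by blast
  qed
  have gain: "u x < u (\<psi> x)" if "x \<in> K" for x
    using \<psi>(2)[of x] F(3) that \<open>K \<subseteq> M\<close> unfolding W_def by fastforce
  have "\<exists>e>0. \<forall>x\<in>K. u x + e \<le> u (\<psi> x)"
  proof (cases "K = {}")
    case True then show ?thesis by (intro exI[of _ 1]) auto
  next
    case False
    let ?h = "\<lambda>x. u (\<psi> x) - u x"
    have "compact (?h ` K)"
      using image_compactin[OF K contd[OF \<psi>(1)]] by simp
    then obtain x0 where "x0 \<in> K" "\<And>x. x \<in> K \<Longrightarrow> ?h x0 \<le> ?h x"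
      using compact_attains_inf[of "?h ` K"] False by auto
    then show ?thesis using gain[of x0] by (intro exI[of _ "?h x0"]) force
  qed
  then show ?thesis using \<psi>(1) by blast
qed

text \<open>While a point of \<open>K\<close> stays at height at most \<open>a\<close> it travels a bounded distance, hence stays in a fixed
  compact set \<open>L\<close>, where a single map \<open>\<psi>\<close> gains at least \<open>e\<close> per application.\<close>

lemma push_above_level:
  assumes HR: "mcomplete" "locally_compact_metric" "length_property"
    and C: "C > 0" and push: "locally_pushable u C" and contu: "continuous_map mtopology euclideanreal u"
    and K: "compactin mtopology K"
  shows "\<exists>\<psi>. pushes u C \<psi> \<and> (\<forall>x\<in>K. a < u (\<psi> x))"
proof -
  have "K \<subseteq> M" using K compactin_subset_topspace by force
  have "bounded (u ` K)"
    using image_compactin[OF K contu] compact_imp_bounded by auto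
  then obtain m where m: "\<And>x. x \<in> K \<Longrightarrow> m \<le> u x"
    using bounded_imp_bdd_below unfolding bdd_below_def by fastforce
  obtain L where L: "compactin mtopology L" "{x \<in> M. \<exists>k\<in>K. d k x \<le> C * (a - m)} \<subseteq> L"
    using Hopf_Rinow_neighbourhood[OF HR K] by blast
  obtain \<psi> e where \<psi>: "pushes u C \<psi>" "e > 0" "\<And>x. x \<in> L \<Longrightarrow> u x + e \<le> u (\<psi> x)"
    using push_gains_on_compact[OF C push contu L(1)] by blast
  have mono: "u x \<le> u (\<psi> x)" if "x \<in> M" for x
    using climbs_mono_or_eq[OF _ C, of u x "\<psi> x"] \<psi>(1) that unfolding pushes_def by fastforce
  have step: "a < u ((\<psi> ^^ n) x) \<or> m + n * e \<le> u ((\<psi> ^^ n) x)" if x: "x \<in> K" for x n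
  proof (induction n)
    case 0
    then show ?case using m[OF x] by simp
  next
    case (Suc n)
    let ?y = "(\<psi> ^^ n) x"
    have cl: "climbs u C x ?y"
      using pushes_funpow[OF \<psi>(1)] x \<open>K \<subseteq> M\<close> unfolding pushes_def by blast
    then have yM: "?y \<in> M" using climbs_in_space by blast
    show ?case
    proof (cases "a < u ?y")
      case True
      then show ?thesis using mono[OF yM] by auto
    next
      case False
      have "d x ?y \<le> C * (u ?y - u x)" using climbs_dist[OF cl] .
      also have "\<dots> \<le> C * (a - m)" using False m[OF x] C by (intro mult_left_mono) auto
      finally have "?y \<in> L" using L(2) x yM by auto
      then show ?thesis using \<psi>(3)[of ?y] Suc False by (auto simp: algebra_simps)
    qed
  qed
  obtain n :: nat where "real n > (a - m) / e" using reals_Archimedean2 by blast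
  then have "m + n * e > a" using \<psi>(2) by (simp add: field_simps)
  then have "\<forall>x\<in>K. a < u ((\<psi> ^^ n) x)" using step by (metis less_le_trans)
  then show ?thesis using pushes_funpow[OF \<psi>(1)] by blast
qed

section \<open>Superlevel sets and ends\<close>

text \<open>Push a path between two points of the superlevel set up into this set. The end points are joined
  to their images by the connected sets along which they climb.\<close>

lemma superlevel_connected:
  assumes HR: "mcomplete" "locally_compact_metric" "length_property"
    and C: "C > 0" and push: "locally_pushable u C" and contu: "continuous_map mtopology euclideanreal u"
    and path: "path_connected_space mtopology"
  shows "connectedin mtopology {x \<in> M. a < u x}"
proof -
  have "\<exists>T. connectedin mtopology T \<and> T \<subseteq> {x \<in> M. a < u x} \<and> p \<in> T \<and> q \<in> T"
    if p: "p \<in> M" "a < u p" and q: "q \<in> M" "a < u q" for p q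
  proof -
    obtain g where g: "pathin mtopology g" "g 0 = p" "g 1 = q"
      using path p q unfolding path_connected_space_def by auto
    define Q where "Q = g ` {0..1}"
    have Q: "compactin mtopology Q" "connectedin mtopology Q" "p \<in> Q" "q \<in> Q"
      using g compactin_path_image connectedin_path_image unfolding Q_def by auto
    obtain \<psi> where \<psi>: "pushes u C \<psi>" "\<And>x. x \<in> Q \<Longrightarrow> a < u (\<psi> x)"
      using push_above_level[OF HR C push contu Q(1)] by blast
    obtain S1 where S1: "connectedin mtopology S1" "p \<in> S1" "\<psi> p \<in> S1" "\<forall>s\<in>S1. u p \<le> u s"
      using climbs_superlevel[OF _ C] \<psi>(1) p unfolding pushes_def by meson
    obtain S2 where S2: "connectedin mtopology S2" "q \<in> S2" "\<psi> q \<in> S2" "\<forall>s\<in>S2. u q \<le> u s"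
      using climbs_superlevel[OF _ C] \<psi>(1) q unfolding pushes_def by meson
    have img: "connectedin mtopology (\<psi> ` Q)"
      using connectedin_continuous_map_image \<psi>(1) Q(2) unfolding pushes_def by blast
    have "connectedin mtopology ((S1 \<union> \<psi> ` Q) \<union> S2)"
      using S1 S2 img Q by (intro connectedin_Un) auto
    moreover from this have "((S1 \<union> \<psi> ` Q) \<union> S2) \<subseteq> M"
      using connectedin_subset_topspace by fastforce
    moreover have "a < u s" if "s \<in> (S1 \<union> \<psi> ` Q) \<union> S2" for s
      using that S1(4) S2(4) \<psi>(2) p(2) q(2) by (auto intro: less_le_trans)
    ultimately have "connectedin mtopology ((S1 \<union> \<psi> ` Q) \<union> S2)"
        "((S1 \<union> \<psi> ` Q) \<union> S2) \<subseteq> {x \<in> M. a < u x}" by blast+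
    then show ?thesis using S1(2) S2(2) by blast
  qed
  then have "connected_space (subtopology mtopology {x \<in> M. a < u x})"
    unfolding connected_space_subconnected connectedin_subtopology by fastforce
  then show ?thesis by (auto simp: connectedin_def)
qed

text \<open>Take \<open>p\<close> in the component chosen by the end, but at distance more than \<open>C * (2 * a)\<close> from \<open>K\<close>. If
  \<open>\<bar>u p\<bar> \<le> a\<close>, then climbing from \<open>p\<close> cannot meet \<open>K\<close>: a point of \<open>K\<close> has height at most \<open>a\<close>, so it
  would be reached after a gain of at most \<open>2 * a\<close>.\<close>

lemma unbounded_component_reaches_level:
  assumes HR: "mcomplete" "locally_compact_metric" "length_property"
    and C: "C > 0" and push: "locally_pushable u C" and contu: "continuous_map mtopology euclideanreal u"
    and K: "compactin mtopology K" and a: "\<And>x. x \<in> K \<Longrightarrow> \<bar>u x\<bar> \<le> a"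
    and e: "e \<in> ends_of mtopology"
  shows "\<exists>x\<in>e K. a < \<bar>u x\<bar>"
proof (rule ccontr)
  assume "\<not> ?thesis"
  then have low: "\<And>x. x \<in> e K \<Longrightarrow> \<bar>u x\<bar> \<le> a" by force
  obtain L0 where L0: "compactin mtopology L0" "{x \<in> M. \<exists>k\<in>K. d k x \<le> C * (2 * a)} \<subseteq> L0"
    using Hopf_Rinow_neighbourhood[OF HR K] by blast
  define L where "L = K \<union> L0"
  have L: "compactin mtopology L" using K L0 compactin_Un unfolding L_def by blast
  have comp: "e J \<in> connected_components_of (subtopology mtopology (M - J))"
    if "compactin mtopology J" for J
    using e that unfolding ends_of_def by auto
  have "e L \<subseteq> e K"
    using e L K unfolding ends_of_def L_def by auto
  moreover obtain p where p: "p \<in> e L"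
    using nonempty_connected_components_of[OF comp[OF L]] by blast
  moreover have "e L \<subseteq> M - L"
    using connected_components_of_subset[OF comp[OF L]] by auto
  ultimately have pK: "p \<in> e K" and pM: "p \<in> M" and far: "\<And>k. k \<in> K \<Longrightarrow> C * (2 * a) < d k p"
    using L0(2) unfolding L_def by force+
  obtain \<psi> where \<psi>: "pushes u C \<psi>" "a < u (\<psi> p)"
    using push_above_level[OF HR C push contu, of "{p}" a] pM by (auto simp: compactin_sing)
  then obtain S where S: "connectedin mtopology S" "p \<in> S" "\<psi> p \<in> S"
      "\<And>s. s \<in> S \<Longrightarrow> d p s \<le> C * (u s - u p)"
    using pM unfolding pushes_def climbs_def by blast
  have "S \<inter> K = {}"
  proof (rule ccontr)
    assume "S \<inter> K \<noteq> {}"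
    then obtain s where s: "s \<in> S" "s \<in> K" by blast
    then have "d p s \<le> C * (u s - u p)" using S by blast
    also have "\<dots> \<le> C * (2 * a)"
      using C a[OF s(2)] low[OF pK] by (intro mult_left_mono) auto
    finally show False using far[OF s(2)] commute by (metis not_le)
  qed
  then have "connectedin (subtopology mtopology (M - K)) S"
    using S(1) connectedin_subset_topspace[OF S(1)] by (auto simp: connectedin_subtopology)
  then have "S \<subseteq> e K"
    using connected_components_of_maximal[OF comp[OF K]] S(2) pK by (auto simp: disjnt_iff)
  then show False using low[of "\<psi> p"] S(3) \<psi>(2) by auto
qed

text \<open>A compact set \<open>K\<close> that tells three ends apart would have three different components, each of them
  containing one of the two connected sets \<open>{u > a}\<close> and \<open>{u < -a}\<close>, where \<open>a\<close> bounds \<open>\<bar>u\<bar>\<close> on \<open>K\<close>.\<close>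

theorem at_most_two_ends:
  assumes HR: "mcomplete" "locally_compact_metric" "length_property"
    and C: "C > 0" and push: "locally_pushable u C" "locally_pushable (\<lambda>x. - u x) C"
    and contu: "continuous_map mtopology euclideanreal u"
    and path: "path_connected_space mtopology"
  shows "finite (ends_of mtopology) \<and> card (ends_of mtopology) \<le> 2"
proof (rule ccontr)
  assume "\<not> ?thesis"
  then obtain E where E: "E \<subseteq> ends_of mtopology" "finite E" "card E = 3"
    by (metis infinite_arbitrarily_large obtain_subset_with_card_n not_less_eq_eq numeral_2_eq_2 numeral_3_eq_3)
  have comp: "e J \<in> connected_components_of (subtopology mtopology (M - J))"
    if "compactin mtopology J" "e \<in> E" for e J
    using E that unfolding ends_of_def by auto
  have mono: "e L \<subseteq> e J" if "e \<in> E" "compactin mtopology L" "compactin mtopology J" "J \<subseteq> L" for e J L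
  proof -
    have "e \<in> ends_of mtopology" using E that by blast
    then show ?thesis using that unfolding ends_of_def by blast
  qed
  have "\<exists>K. compactin mtopology K \<and> e K \<noteq> f K" if "e \<in> E" "f \<in> E" "e \<noteq> f" for e f
  proof -
    have "e \<in> extensional {K. compactin mtopology K}" "f \<in> extensional {K. compactin mtopology K}"
      using that E unfolding ends_of_def by (auto simp: PiE_iff)
    then show ?thesis using that(3) by (metis extensionalityI mem_Collect_eq)
  qed
  then obtain k where k: "\<And>e f. e \<in> E \<Longrightarrow> f \<in> E \<Longrightarrow> e \<noteq> f \<Longrightarrow>
      compactin mtopology (k e f) \<and> e (k e f) \<noteq> f (k e f)" by metis
  \<comment> \<open>a compact set that separates all three ends at once\<close>
  define K where "K = (\<Union>(e,f)\<in>{(e,f) \<in> E \<times> E. e \<noteq> f}. k e f)"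
  have K: "compactin mtopology K"
  proof -
    have "finite {(e,f) \<in> E \<times> E. e \<noteq> f}"
      using E(2) by (auto intro: finite_subset[of _ "E \<times> E"])
    then show ?thesis unfolding K_def using k by (intro compactin_Union) auto
  qed
  have inj: "e = f" if ef: "e \<in> E" "f \<in> E" "e K = f K" for e f
  proof (rule ccontr)
    assume "e \<noteq> f"
    note k = k[OF ef(1,2) this]
    have "k e f \<subseteq> K" using ef \<open>e \<noteq> f\<close> unfolding K_def by auto
    then have "e K \<subseteq> e (k e f) \<inter> f (k e f)" using mono ef K k by blast
    moreover have "e K \<noteq> {}" using nonempty_connected_components_of[OF comp[OF K ef(1)]] .
    moreover have "disjnt (e (k e f)) (f (k e f))"
      using pairwise_disjoint_connected_components_of comp k ef unfolding pairwise_def by metis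
    ultimately show False unfolding disjnt_def by blast
  qed
  have "bounded (u ` K)"
    using image_compactin[OF K contu] compact_imp_bounded by auto
  then obtain a where a: "\<And>x. x \<in> K \<Longrightarrow> \<bar>u x\<bar> \<le> a"
    unfolding bounded_iff by auto
  have contu': "continuous_map mtopology euclideanreal (\<lambda>x. - u x)"
    using contu by (simp add: continuous_map_minus)
  let ?top = "{x \<in> M. a < u x}" and ?bot = "{x \<in> M. a < - u x}"
  have con: "connectedin mtopology ?top" "connectedin mtopology ?bot"
    using superlevel_connected[OF HR C push(1) contu path] superlevel_connected[OF HR C push(2) contu' path]
    by auto
  have absorb: "T \<subseteq> e K" if "e \<in> E" "T = ?top \<or> T = ?bot" "T \<inter> e K \<noteq> {}" for e T
  proof -
    have "T \<inter> K = {}" using that(2) a by fastforce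
    then have "connectedin (subtopology mtopology (M - K)) T"
      using con that(2) by (auto simp: connectedin_subtopology)
    then show ?thesis using connected_components_of_maximal[OF comp[OF K that(1)]] that(3)
      by (auto simp: disjnt_def)
  qed
  have sub: "e K \<subseteq> M" if "e \<in> E" for e
    using connected_components_of_subset[OF comp[OF K that]] by auto
  have meets: "?top \<inter> e K \<noteq> {} \<or> ?bot \<inter> e K \<noteq> {}" if e: "e \<in> E" for e
  proof -
    obtain x where "x \<in> e K" "a < \<bar>u x\<bar>"
      using unbounded_component_reaches_level[OF HR C push(1) contu K, of a e] a e E(1) by blast
    then show ?thesis using sub[OF e] by (auto simp: abs_if split: if_splits)
  qed
  have one: "e = f" if "e \<in> E" "f \<in> E" "T = ?top \<or> T = ?bot" "T \<inter> e K \<noteq> {}" "T \<inter> f K \<noteq> {}" for e f T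
  proof (rule inj[OF that(1,2)], rule ccontr)
    assume "e K \<noteq> f K"
    then have "disjnt (e K) (f K)"
      using pairwise_disjoint_connected_components_of comp[OF K] that(1,2) unfolding pairwise_def by metis
    then show False using absorb[OF that(1,3,4)] absorb[OF that(2,3,5)] that(4) unfolding disjnt_def by blast
  qed
  \<comment> \<open>\<open>T\<close> would be an injection of three ends into the two sets\<close>
  define T where "T e = (if ?top \<inter> e K \<noteq> {} then ?top else ?bot)" for e
  have T: "T e = ?top \<or> T e = ?bot" "T e \<inter> e K \<noteq> {}" if "e \<in> E" for e
    using meets[OF that] unfolding T_def by (simp_all split: if_split)
  have "inj_on T E"
  proof (rule inj_onI)
    fix e f assume ef: "e \<in> E" "f \<in> E" "T e = T f"
    show "e = f" using one[OF ef(1,2) T(1,2)[OF ef(1)]] T(2)[OF ef(2)] ef(3) by simp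
  qed
  moreover have "T ` E \<subseteq> {?top, ?bot}" using T(1) by blast
  ultimately have "card E \<le> card {?top, ?bot}"
    by (intro card_inj_on_le) auto
  then show False using E(3) by (simp add: card_insert_if split: if_splits)
qed

end

section \<open>Charts and the metric tensor in coordinates\<close>

text \<open>Derivatives and metric tensors are continuous for each fixed vector argument only. Linearity in
  this argument turns this into joint continuity, by expansion in a basis.\<close>

lemma continuous_on_linear_family:
  fixes L :: "'c \<Rightarrow> 'b::euclidean_space \<Rightarrow> 'e::real_normed_vector"
    and w :: "'d::topological_space \<Rightarrow> 'b"
  assumes lin: "\<And>t. t \<in> T \<Longrightarrow> linear (L (a t))"
    and cont: "\<And>v. continuous_on T (\<lambda>t. L (a t) v)" and w: "continuous_on T w"
  shows "continuous_on T (\<lambda>t. L (a t) (w t))"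
proof -
  have "L (a t) (w t) = (\<Sum>i\<in>Basis. (w t \<bullet> i) *\<^sub>R L (a t) i)" if "t \<in> T" for t
  proof -
    have "L (a t) (w t) = L (a t) (\<Sum>i\<in>Basis. (w t \<bullet> i) *\<^sub>R i)"
      by (simp add: euclidean_representation)
    also have "\<dots> = (\<Sum>i\<in>Basis. (w t \<bullet> i) *\<^sub>R L (a t) i)"
      using lin[OF that] by (simp add: linear_sum linear_scale)
    finally show ?thesis .
  qed
  moreover have "continuous_on T (\<lambda>t. \<Sum>i\<in>Basis. (w t \<bullet> i) *\<^sub>R L (a t) i)"
    using cont w by (intro continuous_intros) auto
  ultimately show ?thesis by (simp cong: continuous_on_cong)
qed

lemma Ck_on_1_iff:
  "Ck_on 1 S f \<longleftrightarrow> (\<forall>x\<in>S. f differentiable (at x)) \<and>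
     (\<forall>v. continuous_on S (\<lambda>x. frechet_derivative f (at x) v))"
  unfolding One_nat_def Ck_on.simps ..

lemma Ck_on_1_D:
  assumes "Ck_on 1 S f" "x \<in> S"
  shows "(f has_derivative frechet_derivative f (at x)) (at x)"
  using assms unfolding Ck_on_1_iff by (simp add: frechet_derivative_works)

lemma Ck_on_1_linear:
  assumes "Ck_on 1 S f" "x \<in> S"
  shows "linear (frechet_derivative f (at x))"
  using has_derivative_linear[OF Ck_on_1_D[OF assms]] .

lemma Ck_on_1_continuous_frechet:
  assumes "Ck_on 1 S f"
  shows "continuous_on S (\<lambda>x. frechet_derivative f (at x) v)"
  using assms unfolding Ck_on_1_iff by blast

lemma Ck_on_1_continuous:
  assumes "Ck_on 1 S f"
  shows "continuous_on S f"
  using Ck_on_1_D[OF assms] by (meson continuous_at_imp_continuous_on has_derivative_continuous)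

locale riemannian_manifold = smooth_manifold X A
  for X :: "'a topology" and A :: "('a, 'b::euclidean_space) chart set" +
  fixes g :: "('a, 'b) metric_tensor"
  assumes riem: "riemannian_metric A g"
begin

lemma chart_subset: "c \<in> A \<Longrightarrow> fst c \<subseteq> topspace X"
  using charts_cover by blast

lemma chart_at:
  assumes "p \<in> topspace X" obtains c where "c \<in> A" "p \<in> fst c"
  using assms charts_cover by blast

lemma chart_inj: "c \<in> A \<Longrightarrow> inj_on (snd c) (fst c)"
  using homeomorphic_imp_injective_map[OF chart_homeomorphic] chart_subset
  by (fastforce simp: Int_absorb1)

lemma chart_inv_chart [simp]: "c \<in> A \<Longrightarrow> p \<in> fst c \<Longrightarrow> chart_inv c (snd c p) = p"
  unfolding chart_inv_def using chart_inj by simp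

lemma chart_in_range: "p \<in> fst c \<Longrightarrow> snd c p \<in> chart_range c"
  unfolding chart_range_def by simp

lemma chart_inv_in: "x \<in> chart_range c \<Longrightarrow> chart_inv c x \<in> fst c"
  unfolding chart_range_def chart_inv_def by (simp add: inv_into_into)

lemma chart_chart_inv [simp]: "x \<in> chart_range c \<Longrightarrow> snd c (chart_inv c x) = x"
  unfolding chart_range_def chart_inv_def by (simp add: f_inv_into_f)

lemma chart_continuous:
  assumes "c \<in> A" shows "continuous_map (subtopology X (fst c)) euclidean (snd c)"
  using homeomorphic_imp_continuous_map[OF chart_homeomorphic[OF assms]]
  by (simp add: continuous_map_in_subtopology)

lemma chart_inv_continuous:
  assumes c: "c \<in> A" shows "continuous_map (top_of_set (chart_range c)) X (chart_inv c)"
proof -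
  obtain k where k: "homeomorphic_maps (subtopology X (fst c)) (top_of_set (chart_range c)) (snd c) k"
    using chart_homeomorphic[OF c] homeomorphic_map_maps by blast
  have "k x = chart_inv c x" if "x \<in> chart_range c" for x
  proof -
    have "k (snd c (chart_inv c x)) = chart_inv c x"
      using k chart_inv_in[OF that] chart_subset[OF c] unfolding homeomorphic_maps_def by auto
    then show ?thesis using that by simp
  qed
  moreover have "continuous_map (top_of_set (chart_range c)) X k"
    using k unfolding homeomorphic_maps_def by (simp add: continuous_map_in_subtopology)
  ultimately show ?thesis by (auto intro: continuous_map_eq)
qed

lemma openin_chart_vimage:
  assumes c: "c \<in> A" and U: "open U"
  shows "openin X {p \<in> fst c. snd c p \<in> U}"
proof -
  have "openin (subtopology X (fst c)) {p \<in> topspace (subtopology X (fst c)). snd c p \<in> U}"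
    using openin_continuous_map_preimage[OF chart_continuous[OF c]] U by auto
  moreover have "{p \<in> topspace (subtopology X (fst c)). snd c p \<in> U} = {p \<in> fst c. snd c p \<in> U}"
    using chart_subset[OF c] by auto
  ultimately show ?thesis
    using openin_trans_full chart_domain_open[OF c] by metis
qed

lemma open_chart_image:
  assumes c: "c \<in> A" and U: "openin X U"
  shows "open (snd c ` (U \<inter> fst c))"
proof -
  have "openin (subtopology X (fst c)) (U \<inter> fst c)"
    using U by (auto simp: openin_subtopology)
  then have "openin (top_of_set (chart_range c)) (snd c ` (U \<inter> fst c))"
    using homeomorphic_imp_open_map[OF chart_homeomorphic[OF c]] unfolding open_map_def by blast
  then show ?thesis using chart_range_open[OF c] openin_open_trans by blast
qed

lemma continuous_map_if_in_charts:
  assumes "\<And>c. c \<in> A \<Longrightarrow> continuous_on (chart_range c) (F \<circ> chart_inv c)"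
  shows "continuous_map X euclideanreal F"
proof (rule pasting_lemma[where I = A and T = fst and f = "\<lambda>c. F"])
  fix c assume c: "c \<in> A"
  show "openin X (fst c)" using chart_domain_open[OF c] .
  have "continuous_map (top_of_set (chart_range c)) euclideanreal (F \<circ> chart_inv c)"
    using assms[OF c] by simp
  then have "continuous_map (subtopology X (fst c)) euclideanreal ((F \<circ> chart_inv c) \<circ> snd c)"
    using homeomorphic_imp_continuous_map[OF chart_homeomorphic[OF c]] continuous_map_compose by blast
  then show "continuous_map (subtopology X (fst c)) euclideanreal F"
    by (rule continuous_map_eq) (use c in auto)
qed (use charts_cover in blast)+

lemma transition_Ck1:
  assumes "c \<in> A" "c' \<in> A"
  shows "Ck_on 1 (snd c ` (fst c \<inter> fst c')) (transition c c')"
  using transition_smooth[OF assms] unfolding Csmooth_on_def by blast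

lemma g_inner_product:
  assumes "c \<in> A" "p \<in> fst c"
  shows "bilinear (g c p)" "v \<noteq> 0 \<Longrightarrow> g c p v v > 0"
proof -
  have "bilinear (g c p) \<and> (\<forall>v w. g c p v w = g c p w v) \<and> (\<forall>v. v \<noteq> 0 \<longrightarrow> g c p v v > 0)"
    using riem[unfolded riemannian_metric_def, THEN conjunct1] assms by blast
  then show "bilinear (g c p)" "v \<noteq> 0 \<Longrightarrow> g c p v v > 0"
    by auto
qed

lemmas g_bilinear = g_inner_product(1) and g_pos = g_inner_product(2)

lemma g_nonneg: "c \<in> A \<Longrightarrow> p \<in> fst c \<Longrightarrow> g c p v v \<ge> 0"
  using g_pos[of c p v] bilinear_lzero[OF g_bilinear, of c p v] by (cases "v = 0") auto

lemma g_transform: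
  assumes "c \<in> A" "c' \<in> A" "p \<in> fst c" "p \<in> fst c'"
  shows "g c p v w = g c' p (frechet_derivative (transition c c') (at (snd c p)) v)
                            (frechet_derivative (transition c c') (at (snd c p)) w)"
  using riem[unfolded riemannian_metric_def, THEN conjunct2, THEN conjunct2] assms by blast

lemma g_continuous_coord:
  assumes "c \<in> A" shows "continuous_on (chart_range c) (\<lambda>x. g c (chart_inv c x) v w)"
proof -
  have "Csmooth_on (chart_range c) (\<lambda>x. g c (chart_inv c x) v w)"
    using riem[unfolded riemannian_metric_def, THEN conjunct2, THEN conjunct1] assms by blast
  then have "Ck_on 0 (chart_range c) (\<lambda>x. g c (chart_inv c x) v w)"
    unfolding Csmooth_on_def by blast
  then show ?thesis by simp
qed

lemma riem_norm_nonneg: "c \<in> A \<Longrightarrow> p \<in> fst c \<Longrightarrow> riem_norm g c p v \<ge> 0"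
  unfolding riem_norm_def using g_nonneg by simp

lemma riem_norm_scale:
  assumes "c \<in> A" "p \<in> fst c" shows "riem_norm g c p (k *\<^sub>R v) = \<bar>k\<bar> * riem_norm g c p v"
proof -
  have "g c p (k *\<^sub>R v) (k *\<^sub>R v) = k\<^sup>2 * g c p v v"
    by (simp add: bilinear_lmul[OF g_bilinear[OF assms]] bilinear_rmul[OF g_bilinear[OF assms]] power2_eq_square)
  then show ?thesis by (simp add: riem_norm_def real_sqrt_mult)
qed

lemma riem_norm_continuous:
  fixes x v :: "'d::t2_space \<Rightarrow> 'b"
  assumes c: "c \<in> A" and x: "continuous_on T x" "x ` T \<subseteq> chart_range c" and v: "continuous_on T v"
  shows "continuous_on T (\<lambda>t. riem_norm g c (chart_inv c (x t)) (v t))"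
proof -
  have bil: "bilinear (g c (chart_inv c (x t)))" if "t \<in> T" for t
    using x(2) that by (intro g_bilinear c chart_inv_in) auto
  have 1: "continuous_on T (\<lambda>t. g c (chart_inv c (x t)) u w)" for u w
    using continuous_on_compose2[OF g_continuous_coord[OF c] x] .
  have 2: "continuous_on T (\<lambda>t. g c (chart_inv c (x t)) u (v t))" for u
  proof (rule continuous_on_linear_family[where L = "\<lambda>t. g c (chart_inv c (x t)) u" and a = "\<lambda>t. t"])
    show "linear (g c (chart_inv c (x t)) u)" if "t \<in> T" for t
      using bil[OF that] unfolding bilinear_def by blast
  qed (rule 1, rule v)
  have "continuous_on T (\<lambda>t. g c (chart_inv c (x t)) (v t) (v t))"
  proof (rule continuous_on_linear_family[where L = "\<lambda>t w. g c (chart_inv c (x t)) w (v t)" and a = "\<lambda>t. t"])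
    show "linear (\<lambda>w. g c (chart_inv c (x t)) w (v t))" if "t \<in> T" for t
      using bil[OF that] unfolding bilinear_def by blast
  qed (rule 2, rule v)
  then show ?thesis unfolding riem_norm_def by (intro continuous_intros)
qed

text \<open>The Riemannian norm has positive extrema on the compact set \<open>K \<times> sphere 0 1\<close>; the general case follows
  by homogeneity.\<close>

lemma chart_norm_bounds:
  assumes c: "c \<in> A" and K: "compact K" "K \<subseteq> chart_range c"
  shows "\<exists>b B. 0 < b \<and> 0 < B \<and> (\<forall>x\<in>K. \<forall>v.
     b * norm v \<le> riem_norm g c (chart_inv c x) v \<and> riem_norm g c (chart_inv c x) v \<le> B * norm v)"
proof (cases "K = {}")
  case True
  then show ?thesis by (intro exI[of _ 1]) auto
next
  case False
  define T where "T = K \<times> sphere (0::'b) 1"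
  let ?h = "\<lambda>z. riem_norm g c (chart_inv c (fst z)) (snd z)"
  have T: "compact T" unfolding T_def using K by (intro compact_Times) auto
  have "sphere (0::'b) 1 \<noteq> {}" by simp
  then have ne: "T \<noteq> {}" unfolding T_def using False by auto
  have cont: "continuous_on T ?h"
    using c K unfolding T_def by (intro riem_norm_continuous continuous_intros) auto
  obtain z0 where z0: "z0 \<in> T" "\<And>z. z \<in> T \<Longrightarrow> ?h z0 \<le> ?h z"
    using continuous_attains_inf[OF T ne cont] by blast
  obtain z1 where z1: "z1 \<in> T" "\<And>z. z \<in> T \<Longrightarrow> ?h z \<le> ?h z1"
    using continuous_attains_sup[OF T ne cont] by blast
  have pos: "0 < ?h z" if "z \<in> T" for z
    using that K unfolding T_def riem_norm_def
    by (auto intro!: g_pos[OF c] chart_inv_in)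
  have "?h z0 * norm v \<le> riem_norm g c (chart_inv c x) v \<and> riem_norm g c (chart_inv c x) v \<le> ?h z1 * norm v"
    if x: "x \<in> K" for x v
  proof (cases "v = 0")
    case True
    have "chart_inv c x \<in> fst c" using x K(2) by (intro chart_inv_in) blast
    then show ?thesis using True riem_norm_scale[OF c, of "chart_inv c x" 0 v] by simp
  next
    case False
    have z: "(x, v /\<^sub>R norm v) \<in> T" using x False unfolding T_def by simp
    have "riem_norm g c (chart_inv c x) v = norm v * ?h (x, v /\<^sub>R norm v)"
      using riem_norm_scale[OF c chart_inv_in, of x "norm v" "v /\<^sub>R norm v"] x K(2) False
      by (simp add: subset_eq)
    then show ?thesis
      using z0(2)[OF z] z1(2)[OF z] False by (auto simp: mult.commute intro: mult_left_mono)
  qed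
  then show ?thesis using pos[OF z0(1)] pos[OF z1(1)] by blast
qed

section \<open>The speed of a curve\<close>

lemma curve_locally_in_open:
  assumes "continuous_map (top_of_set {a..b::real}) X \<gamma>" "openin X U" "t \<in> {a..b}" "\<gamma> t \<in> U"
  shows "\<exists>\<delta>>0. \<forall>s\<in>{a..b}. dist s t < \<delta> \<longrightarrow> \<gamma> s \<in> U"
proof -
  have "openin (top_of_set {a..b}) {s \<in> {a..b}. \<gamma> s \<in> U}"
    using openin_continuous_map_preimage[OF assms(1,2)] by simp
  then show ?thesis using assms(3,4) unfolding openin_euclidean_subtopology_iff by auto
qed

lemma velocity_transform:
  assumes c: "c \<in> A" "c' \<in> A" and cont: "continuous_map (top_of_set {a..b}) X \<gamma>"
    and t: "t \<in> {a..b}" "\<gamma> t \<in> fst c" "\<gamma> t \<in> fst c'"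
    and D: "((snd c \<circ> \<gamma>) has_vector_derivative D) (at t within {a..b})"
  shows "((snd c' \<circ> \<gamma>) has_vector_derivative
     frechet_derivative (transition c c') (at (snd c (\<gamma> t))) D) (at t within {a..b})"
proof -
  obtain \<delta> where \<delta>: "\<delta> > 0" "\<And>s. s \<in> {a..b} \<Longrightarrow> dist s t < \<delta> \<Longrightarrow> \<gamma> s \<in> fst c"
    using curve_locally_in_open[OF cont chart_domain_open[OF c(1)] t(1,2)] by blast
  have x: "snd c (\<gamma> t) \<in> snd c ` (fst c \<inter> fst c')" using t by auto
  note dT = Ck_on_1_D[OF transition_Ck1[OF c] x]
  then interpret T: linear "frechet_derivative (transition c c') (at (snd c (\<gamma> t)))"
    using has_derivative_bounded_linear bounded_linear.linear by blast
  have "((transition c c' \<circ> (snd c \<circ> \<gamma>)) has_derivative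
     (\<lambda>h. frechet_derivative (transition c c') (at (snd c (\<gamma> t))) (h *\<^sub>R D))) (at t within {a..b})"
    using has_derivative_compose[OF D[unfolded has_vector_derivative_def], of "transition c c'"] dT
    by (simp add: o_def)
  then have "((transition c c' \<circ> (snd c \<circ> \<gamma>)) has_vector_derivative
     frechet_derivative (transition c c') (at (snd c (\<gamma> t))) D) (at t within {a..b})"
    by (simp add: has_vector_derivative_def T.scale)
  then show ?thesis
    using has_vector_derivative_transform_within[OF _ \<delta>(1) t(1)] \<delta>(2) c
    by (fastforce simp: transition_def)
qed

lemma C1_curve_velocity:
  assumes "C1_curve_on X A a b \<gamma>" "a < b" "c \<in> A" "t \<in> {a..b}" "\<gamma> t \<in> fst c"
  shows "((snd c \<circ> \<gamma>) has_vector_derivative vector_derivative (snd c \<circ> \<gamma>) (at t within {a..b})) (at t within {a..b})"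
proof -
  obtain D where D: "((snd c \<circ> \<gamma>) has_vector_derivative D) (at t within {a..b})"
    using assms unfolding C1_curve_on_def by blast
  show ?thesis
    using D by (simp only: vector_derivative_within_closed_interval[OF assms(2,4) D])
qed

lemma C1_curve_velocity_continuous:
  assumes "C1_curve_on X A a b \<gamma>" "a < b" "c \<in> A"
  shows "continuous_on {t \<in> {a..b}. \<gamma> t \<in> fst c} (\<lambda>t. vector_derivative (snd c \<circ> \<gamma>) (at t within {a..b}))"
proof -
  obtain D where D: "continuous_on {t \<in> {a..b}. \<gamma> t \<in> fst c} D"
    "\<And>t. t \<in> {a..b} \<Longrightarrow> \<gamma> t \<in> fst c \<Longrightarrow> ((snd c \<circ> \<gamma>) has_vector_derivative D t) (at t within {a..b})"
    using assms unfolding C1_curve_on_def by blast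
  have "vector_derivative (snd c \<circ> \<gamma>) (at t within {a..b}) = D t" if "t \<in> {a..b}" "\<gamma> t \<in> fst c" for t
    using vector_derivative_within_closed_interval[OF assms(2) that(1) D(2)[OF that]] .
  then show ?thesis by (intro continuous_on_eq[OF D(1)]) auto
qed

lemma C1_curve_in_space: "C1_curve_on X A a b \<gamma> \<Longrightarrow> t \<in> {a..b} \<Longrightarrow> \<gamma> t \<in> topspace X"
  using continuous_map_image_subset_topspace[of "top_of_set {a..b}" X \<gamma>]
  unfolding C1_curve_on_def by auto

text \<open>The speed with one-sided derivatives at \<open>a\<close> and \<open>b\<close>. Unlike \<open>curve_speed\<close> it is continuous on the whole of
  \<open>{a..b}\<close> and agrees with \<open>curve_speed\<close> in the interior, which makes the latter integrable.\<close>

definition one_sided_speed :: "real \<Rightarrow> real \<Rightarrow> (real \<Rightarrow> 'a) \<Rightarrow> real \<Rightarrow> real" where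
  "one_sided_speed a b \<gamma> t = (let c = (SOME c. c \<in> A \<and> \<gamma> t \<in> fst c) in
     riem_norm g c (\<gamma> t) (vector_derivative (snd c \<circ> \<gamma>) (at t within {a..b})))"

lemma one_sided_speed_eq:
  assumes C1: "C1_curve_on X A a b \<gamma>" and ab: "a < b" and t: "t \<in> {a..b}" and c: "c \<in> A" "\<gamma> t \<in> fst c"
  shows "one_sided_speed a b \<gamma> t = riem_norm g c (\<gamma> t) (vector_derivative (snd c \<circ> \<gamma>) (at t within {a..b}))"
proof -
  define c' where "c' = (SOME c. c \<in> A \<and> \<gamma> t \<in> fst c)"
  have c': "c' \<in> A" "\<gamma> t \<in> fst c'"
    using someI[of "\<lambda>c. c \<in> A \<and> \<gamma> t \<in> fst c", OF conjI[OF c]] unfolding c'_def by auto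
  have cont: "continuous_map (top_of_set {a..b}) X \<gamma>" using C1 unfolding C1_curve_on_def by blast
  let ?D = "vector_derivative (snd c \<circ> \<gamma>) (at t within {a..b})"
  have "vector_derivative (snd c' \<circ> \<gamma>) (at t within {a..b}) =
      frechet_derivative (transition c c') (at (snd c (\<gamma> t))) ?D"
    using velocity_transform[OF c(1) c'(1) cont t c(2) c'(2) C1_curve_velocity[OF C1 ab c(1) t c(2)]]
      vector_derivative_within_closed_interval[OF ab t] by blast
  then show ?thesis
    unfolding one_sided_speed_def Let_def riem_norm_def c'_def[symmetric]
    using g_transform[OF c(1) c'(1) c(2) c'(2)] by simp
qed


lemma one_sided_speed_continuous:
  assumes C1: "C1_curve_on X A a b \<gamma>" and ab: "a < b"
  shows "continuous_on {a..b} (one_sided_speed a b \<gamma>)"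
proof -
  have cont: "continuous_map (top_of_set {a..b}) X \<gamma>" using C1 unfolding C1_curve_on_def by blast
  have "continuous (at t within {a..b}) (one_sided_speed a b \<gamma>)" if t: "t \<in> {a..b}" for t
  proof -
    obtain c where c: "c \<in> A" "\<gamma> t \<in> fst c" using chart_at C1_curve_in_space[OF C1 t] by blast
    define T where "T = {t \<in> {a..b}. \<gamma> t \<in> fst c}"
    obtain \<delta> where \<delta>: "\<delta> > 0" "\<And>s. s \<in> {a..b} \<Longrightarrow> dist s t < \<delta> \<Longrightarrow> \<gamma> s \<in> fst c"
      using curve_locally_in_open[OF cont chart_domain_open[OF c(1)] t c(2)] by blast
    let ?D = "\<lambda>t. vector_derivative (snd c \<circ> \<gamma>) (at t within {a..b})"
    have D: "continuous_on T ?D"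
      using C1_curve_velocity_continuous[OF C1 ab c(1)] unfolding T_def .
    have x: "continuous_on T (snd c \<circ> \<gamma>)"
      unfolding continuous_on_eq_continuous_within
    proof
      fix s assume "s \<in> T"
      then have "((snd c \<circ> \<gamma>) has_vector_derivative ?D s) (at s within T)"
        unfolding T_def
        by (intro has_vector_derivative_within_subset[OF C1_curve_velocity[OF C1 ab c(1)]]) auto
      then show "continuous (at s within T) (snd c \<circ> \<gamma>)"
        by (rule has_vector_derivative_continuous)
    qed
    have im: "(snd c \<circ> \<gamma>) ` T \<subseteq> chart_range c"
      unfolding T_def chart_range_def by auto
    have "continuous_on T (\<lambda>t. riem_norm g c (chart_inv c ((snd c \<circ> \<gamma>) t)) (?D t))"
      using riem_norm_continuous[OF c(1) x im D] .
    moreover have "riem_norm g c (chart_inv c ((snd c \<circ> \<gamma>) s)) (?D s) = one_sided_speed a b \<gamma> s"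
      if "s \<in> T" for s
    proof -
      have s: "s \<in> {a..b}" "\<gamma> s \<in> fst c" using that unfolding T_def by auto
      show ?thesis using one_sided_speed_eq[OF C1 ab s(1) c(1) s(2)] chart_inv_chart[OF c(1) s(2)]
        by (simp only: o_apply)
    qed
    ultimately have "continuous_on T (one_sided_speed a b \<gamma>)"
      by (rule continuous_on_eq)
    then have "continuous (at t within T) (one_sided_speed a b \<gamma>)"
      using t c unfolding continuous_on_eq_continuous_within T_def by blast
    moreover have "at t within T = at t within {a..b}"
      by (rule at_within_nhd[of t "ball t \<delta>"]) (use \<delta> in \<open>auto simp: T_def dist_commute\<close>)
    ultimately show ?thesis by simp
  qed
  then show ?thesis unfolding continuous_on_eq_continuous_within by blast
qed

lemma curve_speed_interior:
  assumes "t \<in> {a<..<b}"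
  shows "curve_speed A g \<gamma> t = one_sided_speed a b \<gamma> t"
proof -
  have "at t within {a..b} = at t" using assms by (intro at_within_interior) (simp add: interior_atLeastAtMost_real)
  then show ?thesis unfolding curve_speed_def one_sided_speed_def by simp
qed

lemma curve_speed_eq:
  assumes "C1_curve_on X A a b \<gamma>" "t \<in> {a<..<b}" "c \<in> A" "\<gamma> t \<in> fst c"
    and D: "((snd c \<circ> \<gamma>) has_vector_derivative D) (at t)"
  shows "curve_speed A g \<gamma> t = riem_norm g c (\<gamma> t) D"
proof -
  have "vector_derivative (snd c \<circ> \<gamma>) (at t within {a..b}) = D"
    using vector_derivative_within_closed_interval[OF _ _ has_vector_derivative_at_within[OF D], of a b] assms(2)
    by simp
  then show ?thesis
    using curve_speed_interior[OF assms(2)] one_sided_speed_eq[OF assms(1) _ _ assms(3,4)] assms(2) by simp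
qed

lemma C1_curve_velocity_interior:
  assumes "C1_curve_on X A a b \<gamma>" "t \<in> {a<..<b}" "c \<in> A" "\<gamma> t \<in> fst c"
  obtains D where "((snd c \<circ> \<gamma>) has_vector_derivative D) (at t)"
proof -
  have "at t within {a..b} = at t" using assms(2) by (intro at_within_interior) (simp add: interior_atLeastAtMost_real)
  then show ?thesis using C1_curve_velocity[OF assms(1) _ assms(3) _ assms(4)] assms(2) that by force
qed

lemma curve_speed_nonneg:
  assumes "\<gamma> t \<in> topspace X" shows "curve_speed A g \<gamma> t \<ge> 0"
proof -
  define c where "c = (SOME c. c \<in> A \<and> \<gamma> t \<in> fst c)"
  obtain c0 where "c0 \<in> A" "\<gamma> t \<in> fst c0" using chart_at[OF assms] .
  then have "c \<in> A" "\<gamma> t \<in> fst c"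
    using someI[of "\<lambda>c. c \<in> A \<and> \<gamma> t \<in> fst c" c0] unfolding c_def by auto
  then show ?thesis unfolding curve_speed_def Let_def c_def[symmetric] by (rule riem_norm_nonneg)
qed

lemma curve_speed_integrable:
  assumes "C1_curve_on X A a b \<gamma>" "a < b"
  shows "curve_speed A g \<gamma> integrable_on {a..b}"
proof -
  have "one_sided_speed a b \<gamma> integrable_on {a..b}"
    using one_sided_speed_continuous[OF assms] integrable_continuous_interval by blast
  then show ?thesis
    using integrable_spike_interior[of a b "curve_speed A g \<gamma>" "one_sided_speed a b \<gamma>"] curve_speed_interior
    by (simp add: box_real)
qed

end

section \<open>Lengths of piecewise smooth curves\<close>

context riemannian_manifold
begin

text \<open>Piecewise \<open>C\<^sup>1\<close> curves on an arbitrary interval, together with their length. Joining two pieces is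
  symmetric, so that reversal, rescaling and restriction all follow by rule induction.\<close>

inductive arc_length :: "(real \<Rightarrow> 'a) \<Rightarrow> real \<Rightarrow> real \<Rightarrow> real \<Rightarrow> bool" for \<gamma> where
  C1_arc: "a < b \<Longrightarrow> C1_curve_on X A a b \<gamma> \<Longrightarrow>
     arc_length \<gamma> a b (integral {a..b} (curve_speed A g \<gamma>))"
| join: "arc_length \<gamma> a b l \<Longrightarrow> arc_length \<gamma> b c l' \<Longrightarrow> arc_length \<gamma> a c (l + l')"

lemma arc_length_less: "arc_length \<gamma> a b l \<Longrightarrow> a < b"
  by (induction rule: arc_length.induct) auto

lemma arc_length_has_integral:
  "arc_length \<gamma> a b l \<Longrightarrow> (curve_speed A g \<gamma> has_integral l) {a..b}"
proof (induction rule: arc_length.induct)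
  case (C1_arc a b)
  then show ?case using curve_speed_integrable integrable_integral by blast
next
  case (join a b l c l')
  then show ?case
    using arc_length_less has_integral_combine[of a b c] by (meson less_imp_le)
qed

lemma arc_length_in_space: "arc_length \<gamma> a b l \<Longrightarrow> t \<in> {a..b} \<Longrightarrow> \<gamma> t \<in> topspace X"
proof (induction rule: arc_length.induct)
  case (C1_arc a b)
  then show ?case using C1_curve_in_space by blast
next
  case (join a b l c l')
  then show ?case by (cases "t \<le> b") auto
qed

lemma arc_length_nonneg: "arc_length \<gamma> a b l \<Longrightarrow> 0 \<le> l"
  using has_integral_nonneg[OF arc_length_has_integral] curve_speed_nonneg arc_length_in_space by blast

lemma C1_curve_on_subinterval:
  assumes "C1_curve_on X A a b \<gamma>" "a \<le> a'" "b' \<le> b"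
  shows "C1_curve_on X A a' b' \<gamma>"
  unfolding C1_curve_on_def
proof (intro conjI ballI)
  have sub: "{a'..b'} \<subseteq> {a..b}" using assms by auto
  then show "continuous_map (top_of_set {a'..b'}) X \<gamma>"
    using assms(1) continuous_map_from_subtopology_mono unfolding C1_curve_on_def by blast
  fix c assume "c \<in> A"
  then obtain D where D: "continuous_on {t \<in> {a..b}. \<gamma> t \<in> fst c} D"
    "\<And>t. t \<in> {a..b} \<Longrightarrow> \<gamma> t \<in> fst c \<Longrightarrow> ((snd c \<circ> \<gamma>) has_vector_derivative D t) (at t within {a..b})"
    using assms unfolding C1_curve_on_def by blast
  have "continuous_on {t \<in> {a'..b'}. \<gamma> t \<in> fst c} D"
    using sub by (intro continuous_on_subset[OF D(1)]) auto
  moreover have "((snd c \<circ> \<gamma>) has_vector_derivative D t) (at t within {a'..b'})"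
    if "t \<in> {a'..b'}" "\<gamma> t \<in> fst c" for t
    using that sub by (intro has_vector_derivative_within_subset[OF D(2)]) auto
  ultimately show "\<exists>D. continuous_on {t \<in> {a'..b'}. \<gamma> t \<in> fst c} D \<and>
     (\<forall>t\<in>{a'..b'}. \<gamma> t \<in> fst c \<longrightarrow> ((snd c \<circ> \<gamma>) has_vector_derivative D t) (at t within {a'..b'}))"
    by blast
qed

lemma arc_length_split:
  assumes "arc_length \<gamma> a b l" "a < t" "t < b"
  shows "\<exists>l1 l2. arc_length \<gamma> a t l1 \<and> arc_length \<gamma> t b l2 \<and> l = l1 + l2"
  using assms
proof (induction rule: arc_length.induct)
  case (C1_arc a b)
  have "arc_length \<gamma> a t (integral {a..t} (curve_speed A g \<gamma>))"
       "arc_length \<gamma> t b (integral {t..b} (curve_speed A g \<gamma>))"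
    using C1_arc by (auto intro!: arc_length.C1_arc elim: C1_curve_on_subinterval)
  moreover have "integral {a..b} (curve_speed A g \<gamma>) =
      integral {a..t} (curve_speed A g \<gamma>) + integral {t..b} (curve_speed A g \<gamma>)"
    using C1_arc Henstock_Kurzweil_Integration.integral_combine[of a t b "curve_speed A g \<gamma>"]
      curve_speed_integrable[of a b \<gamma>] by simp
  ultimately show ?case by blast
next
  case (join a b l c l')
  consider "t < b" | "t = b" | "b < t" by linarith
  then show ?case
  proof cases
    case 1
    then obtain l1 l2 where "arc_length \<gamma> a t l1" "arc_length \<gamma> t b l2" "l = l1 + l2"
      using join by blast
    then show ?thesis using join.hyps(2) arc_length.join[of \<gamma> t b l2 c l']
      by (intro exI[of _ l1] exI[of _ "l2 + l'"]) auto
  next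
    case 2
    then show ?thesis using join.hyps by blast
  next
    case 3
    then obtain l1 l2 where "arc_length \<gamma> b t l1" "arc_length \<gamma> t c l2" "l' = l1 + l2"
      using join by blast
    then show ?thesis using join.hyps(1) arc_length.join[of \<gamma> a b l t l1]
      by (intro exI[of _ "l + l1"] exI[of _ "l2"]) auto
  qed
qed

lemma C1_curve_affine:
  assumes C1: "C1_curve_on X A a b \<gamma>" and m: "m \<noteq> 0"
    and into: "\<And>t. t \<in> {a'..b'} \<Longrightarrow> m * t + k \<in> {a..b}"
  shows "C1_curve_on X A a' b' (\<lambda>t. \<gamma> (m * t + k))"
  unfolding C1_curve_on_def
proof (intro conjI ballI)
  define h where "h t = m * t + k" for t
  have cont: "continuous_map (top_of_set {a..b}) X \<gamma>" using C1 unfolding C1_curve_on_def by blast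
  have conth: "continuous_on T h" for T unfolding h_def by (intro continuous_intros)
  have "continuous_map (top_of_set {a'..b'}) (top_of_set {a..b}) h"
    using conth into by (auto simp: continuous_map_in_subtopology h_def)
  from continuous_map_compose[OF this cont]
  show "continuous_map (top_of_set {a'..b'}) X (\<lambda>t. \<gamma> (m * t + k))"
    by (simp add: o_def h_def)
  fix c assume "c \<in> A"
  then obtain D where D: "continuous_on {t \<in> {a..b}. \<gamma> t \<in> fst c} D"
    "\<And>t. t \<in> {a..b} \<Longrightarrow> \<gamma> t \<in> fst c \<Longrightarrow> ((snd c \<circ> \<gamma>) has_vector_derivative D t) (at t within {a..b})"
    using C1 unfolding C1_curve_on_def by blast
  have "continuous_on {t \<in> {a'..b'}. \<gamma> (h t) \<in> fst c} (\<lambda>t. m *\<^sub>R D (h t))"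
    using into by (intro continuous_intros continuous_on_compose2[OF D(1) conth]) (auto simp: h_def)
  moreover have "((snd c \<circ> (\<lambda>t. \<gamma> (h t))) has_vector_derivative m *\<^sub>R D (h t)) (at t within {a'..b'})"
    if "t \<in> {a'..b'}" "\<gamma> (h t) \<in> fst c" for t
  proof -
    have "(h has_vector_derivative m) (at t within {a'..b'})"
      unfolding h_def by (auto intro!: derivative_eq_intros)
    moreover have "((snd c \<circ> \<gamma>) has_vector_derivative D (h t)) (at (h t) within h ` {a'..b'})"
      using that into by (intro has_vector_derivative_within_subset[OF D(2)]) (auto simp: h_def)
    ultimately show ?thesis
      using vector_diff_chain_within[of h m t "{a'..b'}" "snd c \<circ> \<gamma>"] by (simp add: o_def)
  qed
  ultimately show "\<exists>D. continuous_on {t \<in> {a'..b'}. \<gamma> (m * t + k) \<in> fst c} D \<and>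
     (\<forall>t\<in>{a'..b'}. \<gamma> (m * t + k) \<in> fst c \<longrightarrow>
        ((snd c \<circ> (\<lambda>t. \<gamma> (m * t + k))) has_vector_derivative D t) (at t within {a'..b'}))"
    unfolding h_def by (intro exI[of _ "\<lambda>t. m *\<^sub>R D (m * t + k)"]) blast
qed

lemma curve_speed_affine:
  assumes C1: "C1_curve_on X A a b \<gamma>" and m: "m \<noteq> 0"
    and into: "\<And>t. t \<in> {a'..b'} \<Longrightarrow> m * t + k \<in> {a..b}"
    and t: "t \<in> {a'<..<b'}" "m * t + k \<in> {a<..<b}"
  shows "curve_speed A g (\<lambda>t. \<gamma> (m * t + k)) t = \<bar>m\<bar> * curve_speed A g \<gamma> (m * t + k)"
proof -
  have "\<gamma> (m * t + k) \<in> topspace X" using C1_curve_in_space[OF C1] t by auto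
  then obtain c where c: "c \<in> A" "\<gamma> (m * t + k) \<in> fst c" by (rule chart_at)
  obtain D where D: "((snd c \<circ> \<gamma>) has_vector_derivative D) (at (m * t + k))"
    using C1_curve_velocity_interior[OF C1 t(2) c] .
  have "((\<lambda>t. m * t + k) has_vector_derivative m) (at t)"
    by (auto intro!: derivative_eq_intros)
  then have D': "((snd c \<circ> (\<lambda>t. \<gamma> (m * t + k))) has_vector_derivative m *\<^sub>R D) (at t)"
    using vector_diff_chain_at[of "\<lambda>t. m * t + k" m t "snd c \<circ> \<gamma>" D] D by (simp add: o_def)
  show ?thesis
    using curve_speed_eq[OF C1_curve_affine[OF C1 m into] t(1) c(1) c(2) D'] curve_speed_eq[OF C1 t(2) c D]
      riem_norm_scale[OF c] by simp
qed

lemma arc_length_C1I: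
  assumes "a < b" "C1_curve_on X A a b \<gamma>" "(f has_integral l) {a..b}"
    and "\<And>t. t \<in> {a<..<b} \<Longrightarrow> curve_speed A g \<gamma> t = f t"
  shows "arc_length \<gamma> a b l"
proof -
  have "(curve_speed A g \<gamma> has_integral l) (cbox a b)"
    by (rule has_integral_spike_interior[of f]) (use assms(3,4) in auto)
  then have "integral {a..b} (curve_speed A g \<gamma>) = l" by (simp add: integral_unique)
  then show ?thesis using arc_length.C1_arc[OF assms(1,2)] by simp
qed

lemma arc_length_rescale:
  assumes "arc_length \<gamma> a b l" and m: "m > 0"
  shows "arc_length (\<lambda>t. \<gamma> (m * t + k)) ((a - k) / m) ((b - k) / m) l"
  using assms(1)
proof (induction rule: arc_length.induct)
  case (C1_arc a b)
  let ?f = "curve_speed A g \<gamma>"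
  have into: "m * t + k \<in> {a..b}" if "t \<in> {(a - k) / m..(b - k) / m}" for t
    using that m by (auto simp: field_simps)
  have into': "m * t + k \<in> {a<..<b}" if "t \<in> {(a - k) / m<..<(b - k) / m}" for t
    using that m by (auto simp: field_simps)
  have "(?f has_integral integral {a..b} ?f) (cbox a b)"
    using curve_speed_integrable[OF C1_arc(2,1)] integrable_integral by (simp add: box_real)
  then have "((\<lambda>t. ?f (m * t + k)) has_integral integral {a..b} ?f / m) {(a - k) / m..(b - k) / m}"
    using has_integral_affinity'[of ?f _ a b m k] m by (simp add: divide_inverse_commute)
  then have "((\<lambda>t. m * ?f (m * t + k)) has_integral m * (integral {a..b} ?f / m)) {(a - k) / m..(b - k) / m}"
    by (rule has_integral_mult_right)
  then have "((\<lambda>t. m * ?f (m * t + k)) has_integral integral {a..b} ?f) {(a - k) / m..(b - k) / m}"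
    using m by simp
  moreover have "(a - k) / m < (b - k) / m" using C1_arc m by (simp add: divide_strict_right_mono)
  moreover have "C1_curve_on X A ((a - k) / m) ((b - k) / m) (\<lambda>t. \<gamma> (m * t + k))"
    using C1_curve_affine[OF C1_arc(2) _ into] m by simp
  ultimately show ?case
    using curve_speed_affine[OF C1_arc(2) _ into _ into'] m
    by (intro arc_length_C1I[where f = "\<lambda>t. m * ?f (m * t + k)"]) auto
qed (rule arc_length.join)

lemma arc_length_reflect:
  "arc_length \<gamma> a b l \<Longrightarrow> arc_length (\<lambda>t. \<gamma> (- t)) (- b) (- a) l"
proof (induction rule: arc_length.induct)
  case (C1_arc a b)
  let ?f = "curve_speed A g \<gamma>"
  have into: "(- 1) * t + 0 \<in> {a..b}" if "t \<in> {- b..- a}" for t :: real using that by auto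
  have "(?f has_integral integral {a..b} ?f) {a..b}"
    using curve_speed_integrable[OF C1_arc(2,1)] integrable_integral by blast
  then have "((\<lambda>t. ?f (- t)) has_integral integral {a..b} ?f) {- b..- a}" by simp
  moreover have "C1_curve_on X A (- b) (- a) (\<lambda>t. \<gamma> (- t))"
    using C1_curve_affine[OF C1_arc(2) _ into] by simp
  moreover have "curve_speed A g (\<lambda>t. \<gamma> (- t)) t = ?f (- t)" if "t \<in> {- b<..<- a}" for t
    using curve_speed_affine[OF C1_arc(2) _ into that] that by simp
  ultimately show ?case
    using C1_arc(1) by (intro arc_length_C1I[where f = "\<lambda>t. ?f (- t)"]) auto
next
  case (join a b l c l')
  then show ?case using arc_length.join[of "\<lambda>t. \<gamma> (- t)" "- c" "- b" l' "- a" l] by (simp add: add.commute)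
qed

lemma C1_curve_on_cong:
  assumes "C1_curve_on X A a b \<gamma>" and eq: "\<And>t. t \<in> {a..b} \<Longrightarrow> \<gamma>' t = \<gamma> t"
  shows "C1_curve_on X A a b \<gamma>'"
  unfolding C1_curve_on_def
proof (intro conjI ballI)
  show "continuous_map (top_of_set {a..b}) X \<gamma>'"
    using assms(1) eq unfolding C1_curve_on_def by (auto intro: continuous_map_eq[of _ _ \<gamma>])
  fix c assume "c \<in> A"
  then obtain D where D: "continuous_on {t \<in> {a..b}. \<gamma> t \<in> fst c} D"
    "\<And>t. t \<in> {a..b} \<Longrightarrow> \<gamma> t \<in> fst c \<Longrightarrow> ((snd c \<circ> \<gamma>) has_vector_derivative D t) (at t within {a..b})"
    using assms unfolding C1_curve_on_def by blast
  have "{t \<in> {a..b}. \<gamma>' t \<in> fst c} = {t \<in> {a..b}. \<gamma> t \<in> fst c}" using eq by auto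
  moreover have "((snd c \<circ> \<gamma>') has_vector_derivative D t) (at t within {a..b})"
    if "t \<in> {a..b}" "\<gamma>' t \<in> fst c" for t
    by (rule has_vector_derivative_transform[OF that(1) _ D(2)[OF that(1)]]) (use that eq in auto)
  ultimately show "\<exists>D. continuous_on {t \<in> {a..b}. \<gamma>' t \<in> fst c} D \<and>
     (\<forall>t\<in>{a..b}. \<gamma>' t \<in> fst c \<longrightarrow> ((snd c \<circ> \<gamma>') has_vector_derivative D t) (at t within {a..b}))"
    using D(1) by auto
qed

lemma arc_length_cong:
  assumes "arc_length \<gamma> a b l" "\<And>t. t \<in> {a..b} \<Longrightarrow> \<gamma>' t = \<gamma> t"
  shows "arc_length \<gamma>' a b l"
  using assms
proof (induction rule: arc_length.induct)
  case (C1_arc a b)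
  have "curve_speed A g \<gamma>' t = curve_speed A g \<gamma> t" if t: "t \<in> {a<..<b}" for t
  proof -
    have "\<gamma> t \<in> topspace X" using C1_curve_in_space[OF C1_arc(2)] t by auto
    then obtain c where c: "c \<in> A" "\<gamma> t \<in> fst c" by (rule chart_at)
    obtain D where D: "((snd c \<circ> \<gamma>) has_vector_derivative D) (at t)"
      using C1_curve_velocity_interior[OF C1_arc(2) t c] .
    have D': "((snd c \<circ> \<gamma>') has_vector_derivative D) (at t)"
      by (rule has_vector_derivative_transform_within_open[OF D _ t]) (use C1_arc(3) in auto)
    have c': "\<gamma>' t \<in> fst c" "\<gamma>' t = \<gamma> t" using c C1_arc(3) t by auto
    show ?thesis
      using curve_speed_eq[OF C1_curve_on_cong[OF C1_arc(2,3)] t c(1) c'(1) D'] curve_speed_eq[OF C1_arc(2) t c D]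
        c'(2) by simp
  qed
  then show ?case
    using C1_arc(1,2) C1_curve_on_cong[OF C1_arc(2,3)] curve_speed_integrable[OF C1_arc(2,1)]
    by (intro arc_length_C1I[where f = "curve_speed A g \<gamma>"]) (auto simp: integrable_integral)
next
  case (join a b l c l')
  have "arc_length \<gamma>' a b l" "arc_length \<gamma>' b c l'"
    using join arc_length_less[OF join.hyps(1)] arc_length_less[OF join.hyps(2)] by auto
  then show ?case by (rule arc_length.join)
qed

text \<open>By rescaling it does not matter on which interval the curve is defined.\<close>

definition curve_of_length :: "'a \<Rightarrow> 'a \<Rightarrow> real \<Rightarrow> bool" where
  "curve_of_length p q l \<longleftrightarrow> (\<exists>\<gamma> a b. arc_length \<gamma> a b l \<and> \<gamma> a = p \<and> \<gamma> b = q)"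

lemma curve_of_length_sym: "curve_of_length p q l \<Longrightarrow> curve_of_length q p l"
  unfolding curve_of_length_def using arc_length_reflect by (metis minus_minus)

lemma curve_of_length_trans:
  assumes "curve_of_length p q l" "curve_of_length q r l'"
  shows "curve_of_length p r (l + l')"
proof -
  obtain \<gamma> a b where \<gamma>: "arc_length \<gamma> a b l" "\<gamma> a = p" "\<gamma> b = q"
    using assms(1) unfolding curve_of_length_def by blast
  obtain \<beta> c e where \<beta>: "arc_length \<beta> c e l'" "\<beta> c = q" "\<beta> e = r"
    using assms(2) unfolding curve_of_length_def by blast
  define \<alpha> where "\<alpha> t = (if t \<le> b then \<gamma> t else \<beta> (t + (c - b)))" for t
  have less: "a < b" "c < e" using \<gamma> \<beta> arc_length_less by blast+
  have "arc_length \<alpha> a b l"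
    by (rule arc_length_cong[OF \<gamma>(1)]) (simp add: \<alpha>_def)
  moreover have "arc_length \<alpha> b (b + (e - c)) l'"
  proof (rule arc_length_cong)
    show "arc_length (\<lambda>t. \<beta> (1 * t + (c - b))) b (b + (e - c)) l'"
      using arc_length_rescale[OF \<beta>(1), of 1 "c - b"] by (simp add: algebra_simps)
    show "\<alpha> t = \<beta> (1 * t + (c - b))" if "t \<in> {b..b + (e - c)}" for t
      using that \<gamma>(3) \<beta>(2) by (cases "t = b") (simp_all add: \<alpha>_def)
  qed
  ultimately have "arc_length \<alpha> a (b + (e - c)) (l + l')" by (rule arc_length.join)
  moreover have "\<alpha> a = p" "\<alpha> (b + (e - c)) = r" using \<gamma> \<beta> less by (auto simp: \<alpha>_def)
  ultimately show ?thesis unfolding curve_of_length_def by blast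
qed

lemma arc_length_if_subdivision:
  assumes s: "\<And>i. i < n \<Longrightarrow> s i < s (Suc i) \<and> C1_curve_on X A (s i) (s (Suc i)) \<gamma>" and n: "n > (0::nat)"
  shows "\<exists>l. arc_length \<gamma> (s 0) (s n) l"
  using n s
proof (induction n rule: nat_induct_non_zero)
  case 1
  then show ?case using arc_length.C1_arc[of "s 0" "s 1" \<gamma>] by auto
next
  case (Suc n)
  then obtain l where "arc_length \<gamma> (s 0) (s n) l" by auto
  moreover have "\<exists>l'. arc_length \<gamma> (s n) (s (Suc n)) l'"
    using Suc.prems[of n] arc_length.C1_arc[of "s n" "s (Suc n)" \<gamma>] by auto
  ultimately show ?case using arc_length.join by blast
qed

lemma subdivision_if_arc_length:
  assumes "arc_length \<gamma> a b l"
  shows "\<exists>(n::nat) s. s 0 = a \<and> s n = b \<and>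
     (\<forall>i<n. s i < s (Suc i) \<and> C1_curve_on X A (s i) (s (Suc i)) \<gamma>)"
  using assms
proof (induction rule: arc_length.induct)
  case (C1_arc a b)
  then show ?case by (intro exI[of _ 1] exI[of _ "\<lambda>i. if i = 0 then a else b"]) auto
next
  case (join a b l c l')
  obtain n :: nat and s where s: "s 0 = a" "s n = b"
      "\<And>i. i < n \<Longrightarrow> s i < s (Suc i) \<and> C1_curve_on X A (s i) (s (Suc i)) \<gamma>"
    using join.IH(1) by blast
  obtain m :: nat and r where r: "r 0 = b" "r m = c"
      "\<And>i. i < m \<Longrightarrow> r i < r (Suc i) \<and> C1_curve_on X A (r i) (r (Suc i)) \<gamma>"
    using join.IH(2) by blast
  define q where "q i = (if i \<le> n then s i else r (i - n))" for i
  have "q i < q (Suc i) \<and> C1_curve_on X A (q i) (q (Suc i)) \<gamma>" if "i < n + m" for i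
  proof (cases "i < n")
    case True
    then show ?thesis using s(3)[of i] by (simp add: q_def)
  next
    case False
    then have "q i = r (i - n)" "q (Suc i) = r (Suc (i - n))" "i - n < m"
      using s(2) r(1) that by (auto simp: q_def Suc_diff_le)
    then show ?thesis using r(3)[of "i - n"] by simp
  qed
  moreover have "q 0 = a" "q (n + m) = c" using s r by (auto simp: q_def)
  ultimately show ?case by blast
qed

text \<open>The lengths of the curves parametrized by \<open>{0..1}\<close>, over which the Riemannian distance is the
  infimum.\<close>

lemma curve_of_length_iff:
  "curve_of_length p q l \<longleftrightarrow>
     (\<exists>\<gamma>. piecewise_C1_curve X A \<gamma> \<and> \<gamma> 0 = p \<and> \<gamma> 1 = q \<and> curve_length A g \<gamma> = l)"
proof
  assume "curve_of_length p q l"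
  then obtain \<gamma> a b where \<gamma>: "arc_length \<gamma> a b l" "\<gamma> a = p" "\<gamma> b = q"
    unfolding curve_of_length_def by blast
  let ?\<beta> = "\<lambda>t. \<gamma> ((b - a) * t + a)"
  have ab: "0 < b - a" using arc_length_less[OF \<gamma>(1)] by simp
  then have \<beta>: "arc_length ?\<beta> 0 1 l"
    using arc_length_rescale[OF \<gamma>(1) ab, of a] by simp
  have "piecewise_C1_curve X A ?\<beta>"
    unfolding piecewise_C1_curve_def using subdivision_if_arc_length[OF \<beta>] .
  moreover have "curve_length A g ?\<beta> = l"
    unfolding curve_length_def using arc_length_has_integral[OF \<beta>] by (rule integral_unique)
  ultimately show "\<exists>\<gamma>. piecewise_C1_curve X A \<gamma> \<and> \<gamma> 0 = p \<and> \<gamma> 1 = q \<and> curve_length A g \<gamma> = l"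
    using \<gamma> by (intro exI[of _ ?\<beta>]) auto
next
  assume "\<exists>\<gamma>. piecewise_C1_curve X A \<gamma> \<and> \<gamma> 0 = p \<and> \<gamma> 1 = q \<and> curve_length A g \<gamma> = l"
  then obtain \<gamma> and n :: nat and s where \<gamma>: "\<gamma> 0 = p" "\<gamma> 1 = q" "curve_length A g \<gamma> = l"
      "s 0 = 0" "s n = 1" "\<And>i. i < n \<Longrightarrow> s i < s (Suc i) \<and> C1_curve_on X A (s i) (s (Suc i)) \<gamma>"
    unfolding piecewise_C1_curve_def by blast
  have "n > 0" using \<gamma>(4,5) by (cases n) auto
  then obtain l' where l': "arc_length \<gamma> 0 1 l'"
    using arc_length_if_subdivision[of n s \<gamma>] \<gamma>(4-6) by auto
  have "l' = l"
    using arc_length_has_integral[OF l'] \<gamma>(3) unfolding curve_length_def by (simp add: integral_unique)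
  then show "curve_of_length p q l" using l' \<gamma> unfolding curve_of_length_def by blast
qed

end

section \<open>Bounds for lengths in a chart\<close>

lemma has_real_derivative_max_0_squared:
  "((\<lambda>s::real. (max 0 s)\<^sup>2) has_real_derivative 2 * max 0 s) (at s)"
proof -
  consider "s > 0" | "s < 0" | "s = 0" by linarith
  then show ?thesis
  proof cases
    case 1
    have "((\<lambda>s::real. s\<^sup>2) has_real_derivative 2 * max 0 s) (at s)"
      using 1 by (auto intro!: derivative_eq_intros)
    then show ?thesis
      by (rule has_field_derivative_transform_within_open[where S = "{0<..}"]) (use 1 in auto)
  next
    case 2
    have "((\<lambda>s::real. 0) has_real_derivative 2 * max 0 s) (at s)"
      using 2 by (auto intro!: derivative_eq_intros)
    then show ?thesis
      by (rule has_field_derivative_transform_within_open[where S = "{..<0}"]) (use 2 in auto)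
  next
    case 3
    have "((\<lambda>h::real. max 0 h) \<longlongrightarrow> max 0 0) (at 0)"
      by (intro tendsto_intros)
    moreover have "(\<lambda>h::real. ((max 0 (0 + h))\<^sup>2 - (max 0 0)\<^sup>2) / h) = (\<lambda>h. max 0 h)"
      by (auto simp: power2_eq_square max_def)
    ultimately show ?thesis using 3 by (simp add: DERIV_def)
  qed
qed

context riemannian_manifold
begin

text \<open>Along the curve the derivative of \<open>F\<close> is at most \<open>L\<close> times the speed. The chart in which \<open>F\<close> is
  differentiated may depend on the point, as the speed is the same in all charts.\<close>

lemma arc_length_lipschitz:
  assumes arc: "arc_length \<gamma> a b l" and L: "L \<ge> 0"
    and F: "\<And>p. p \<in> topspace X \<Longrightarrow> \<exists>c\<in>A. \<exists>F'. p \<in> fst c \<and>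
      ((F \<circ> chart_inv c) has_derivative F') (at (snd c p)) \<and> (\<forall>v. \<bar>F' v\<bar> \<le> L * riem_norm g c p v)"
  shows "\<bar>F (\<gamma> b) - F (\<gamma> a)\<bar> \<le> L * l"
  using arc
proof (induction rule: arc_length.induct)
  case (C1_arc a b)
  note C1 = C1_arc(2)
  have cont: "continuous_map (top_of_set {a..b}) X \<gamma>" using C1 unfolding C1_curve_on_def by blast
  have der: "\<exists>f'. ((F \<circ> \<gamma>) has_vector_derivative f') (at t within {a..b}) \<and>
      (t \<in> {a<..<b} \<longrightarrow> \<bar>f'\<bar> \<le> L * curve_speed A g \<gamma> t)" if t: "t \<in> {a..b}" for t
  proof -
    obtain c F' where c: "c \<in> A" "\<gamma> t \<in> fst c" and F': "((F \<circ> chart_inv c) has_derivative F') (at (snd c (\<gamma> t)))"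
        "\<And>v. \<bar>F' v\<bar> \<le> L * riem_norm g c (\<gamma> t) v"
      using F[OF C1_curve_in_space[OF C1 t]] by blast
    define D where "D = vector_derivative (snd c \<circ> \<gamma>) (at t within {a..b})"
    have D: "((snd c \<circ> \<gamma>) has_vector_derivative D) (at t within {a..b})"
      unfolding D_def by (rule C1_curve_velocity[OF C1 C1_arc(1) c(1) t c(2)])
    obtain \<delta> where \<delta>: "\<delta> > 0" "\<And>s. s \<in> {a..b} \<Longrightarrow> dist s t < \<delta> \<Longrightarrow> \<gamma> s \<in> fst c"
      using curve_locally_in_open[OF cont chart_domain_open[OF c(1)] t c(2)] by blast
    interpret F': linear F' using has_derivative_linear[OF F'(1)] .
    have "((\<lambda>s. (F \<circ> chart_inv c) ((snd c \<circ> \<gamma>) s)) has_derivative (\<lambda>h. F' (h *\<^sub>R D))) (at t within {a..b})"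
      by (rule has_derivative_compose[OF D[unfolded has_vector_derivative_def]]) (use F'(1) in \<open>simp add: o_def\<close>)
    then have "((\<lambda>s. (F \<circ> chart_inv c) ((snd c \<circ> \<gamma>) s)) has_vector_derivative F' D) (at t within {a..b})"
      by (simp add: has_vector_derivative_def F'.scale)
    then have "((F \<circ> \<gamma>) has_vector_derivative F' D) (at t within {a..b})"
      by (rule has_vector_derivative_transform_within[OF _ \<delta>(1) t])
         (use \<delta>(2) chart_inv_chart[OF c(1)] in simp)
    moreover have "\<bar>F' D\<bar> \<le> L * curve_speed A g \<gamma> t" if "t \<in> {a<..<b}"
      using F'(2)[of D] one_sided_speed_eq[OF C1 C1_arc(1) t c] curve_speed_interior[OF that, of \<gamma>]
      unfolding D_def by simp
    ultimately show ?thesis by blast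
  qed
  then obtain f' where f': "\<And>t. t \<in> {a..b} \<Longrightarrow> ((F \<circ> \<gamma>) has_vector_derivative f' t) (at t within {a..b})"
      "\<And>t. t \<in> {a<..<b} \<Longrightarrow> \<bar>f' t\<bar> \<le> L * curve_speed A g \<gamma> t"
    by (metis greaterThanLessThan_subseteq_atLeastAtMost_iff order_refl subsetD)
  \<comment> \<open>at the end points \<open>curve_speed\<close> is an arbitrary nonnegative number, unrelated to \<open>f'\<close>\<close>
  define f'' where "f'' t = (if t \<in> {a<..<b} then f' t else 0)" for t
  have "(f' has_integral (F \<circ> \<gamma>) b - (F \<circ> \<gamma>) a) {a..b}"
    using fundamental_theorem_of_calculus[of a b "F \<circ> \<gamma>" f'] f'(1) C1_arc(1) by simp
  then have int: "(f'' has_integral F (\<gamma> b) - F (\<gamma> a)) {a..b}"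
    using has_integral_spike_interior[of f' _ a b f''] by (simp add: f''_def)
  have speed: "((\<lambda>t. L * curve_speed A g \<gamma> t) has_integral L * integral {a..b} (curve_speed A g \<gamma>)) {a..b}"
    using curve_speed_integrable[OF C1 C1_arc(1)] by (intro has_integral_mult_right integrable_integral)
  have bound: "\<bar>f'' t\<bar> \<le> L * curve_speed A g \<gamma> t" if "t \<in> {a..b}" for t
    using f'(2)[of t] curve_speed_nonneg[of \<gamma> t, OF C1_curve_in_space[OF C1 that]] L
    by (simp add: f''_def)
  have "F (\<gamma> b) - F (\<gamma> a) \<le> L * integral {a..b} (curve_speed A g \<gamma>)"
    by (rule has_integral_le[OF int speed]) (use bound in force)
  moreover have "- (F (\<gamma> b) - F (\<gamma> a)) \<le> L * integral {a..b} (curve_speed A g \<gamma>)"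
    by (rule has_integral_le[OF has_integral_neg[OF int] speed]) (use bound in force)
  ultimately show ?case by linarith
next
  case (join a b l c l')
  then show ?case by (simp add: algebra_simps)
qed

lemma curve_in_space: "curve_of_length p q l \<Longrightarrow> p \<in> topspace X \<and> q \<in> topspace X"
  unfolding curve_of_length_def using arc_length_in_space arc_length_less by fastforce

lemma curve_of_length_nonneg: "curve_of_length p q l \<Longrightarrow> 0 \<le> l"
  unfolding curve_of_length_def using arc_length_nonneg by blast

lemma compactin_chart_inv_image:
  assumes "c \<in> A" "compact K" "K \<subseteq> chart_range c"
  shows "compactin X (chart_inv c ` K)"
proof -
  have "compactin (top_of_set (chart_range c)) K" using assms(2,3) by (simp add: compactin_subtopology)
  then show ?thesis using image_compactin chart_inv_continuous[OF assms(1)] by blast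
qed

text \<open>The bump function \<open>F\<close> has value \<open>r ^ 4\<close> at \<open>p\<close>, vanishes outside the coordinate ball, and is Lipschitz along
  curves. It avoids any discussion of the first time at which a curve leaves the chart.\<close>

lemma short_curves_stay_in_chart:
  assumes c: "c \<in> A" "p \<in> fst c" and r: "r > 0" "cball (snd c p) r \<subseteq> chart_range c"
  shows "\<exists>\<delta>>0. \<forall>q l. curve_of_length p q l \<longrightarrow> l < \<delta> \<longrightarrow> q \<in> fst c \<and> dist (snd c p) (snd c q) < r"
proof -
  define x0 where "x0 = snd c p"
  define \<phi> where "\<phi> x = (max 0 (r\<^sup>2 - (x - x0) \<bullet> (x - x0)))\<^sup>2" for x
  define F where "F q = (if q \<in> fst c then \<phi> (snd c q) else 0)" for q
  define K where "K = chart_inv c ` cball x0 r"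
  have K: "closedin X K"
    using compactin_imp_closedin[OF Hausdorff compactin_chart_inv_image[OF c(1)]] r
    unfolding K_def x0_def by simp
  obtain b where b: "b > 0" "\<And>x v. x \<in> cball x0 r \<Longrightarrow> b * norm v \<le> riem_norm g c (chart_inv c x) v"
    using chart_norm_bounds[OF c(1) compact_cball] r(2) unfolding x0_def by meson
  define L where "L = 4 * r ^ 3 / b"
  have L: "L > 0" using r b by (simp add: L_def)
  have \<phi>_zero: "\<phi> x = 0" if "r \<le> dist x0 x" for x
  proof -
    have "r\<^sup>2 \<le> (dist x0 x)\<^sup>2" using that r(1) by (intro power_mono) auto
    moreover have "(dist x0 x)\<^sup>2 = (x - x0) \<bullet> (x - x0)"
      by (metis dist_commute dist_norm power2_norm_eq_inner)
    ultimately have "r\<^sup>2 \<le> (x - x0) \<bullet> (x - x0)" by simp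
    then show ?thesis by (simp add: \<phi>_def)
  qed
  have F_zero: "F q = 0" if "q \<notin> fst c \<or> r \<le> dist x0 (snd c q)" for q
    using that \<phi>_zero by (auto simp: F_def)
  have deriv: "\<exists>c'\<in>A. \<exists>F'. q \<in> fst c' \<and> ((F \<circ> chart_inv c') has_derivative F') (at (snd c' q)) \<and>
      (\<forall>v. \<bar>F' v\<bar> \<le> L * riem_norm g c' q v)" if q: "q \<in> topspace X" for q
  proof (cases "q \<in> K")
    case True
    then obtain x where x: "x \<in> cball x0 r" "q = chart_inv c x" unfolding K_def by blast
    then have xR: "x \<in> chart_range c" using r(2) unfolding x0_def by blast
    then have q: "q \<in> fst c" "snd c q = x" using x(2) chart_inv_in[OF xR] by simp_all
    define F' where "F' v = 2 * max 0 (r\<^sup>2 - (x - x0) \<bullet> (x - x0)) * (- 2 * ((x - x0) \<bullet> v))" for v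
    have "((\<lambda>x. r\<^sup>2 - (x - x0) \<bullet> (x - x0)) has_derivative (\<lambda>v. - 2 * ((x - x0) \<bullet> v))) (at x)"
      by (auto intro!: derivative_eq_intros simp: inner_commute)
    from has_derivative_compose[OF this has_real_derivative_max_0_squared[THEN has_field_derivative_imp_has_derivative]]
    have "(\<phi> has_derivative F') (at x)"
      unfolding \<phi>_def F'_def by simp
    then have "((F \<circ> chart_inv c) has_derivative F') (at x)"
      by (rule has_derivative_transform_within_open[OF _ chart_range_open[OF c(1)] xR])
         (simp add: F_def chart_inv_in)
    moreover have "\<bar>F' v\<bar> \<le> L * riem_norm g c q v" for v
    proof -
      have nx: "norm (x - x0) \<le> r" using x(1) by (simp add: dist_norm norm_minus_commute)
      have "\<bar>F' v\<bar> = 4 * max 0 (r\<^sup>2 - (x - x0) \<bullet> (x - x0)) * \<bar>(x - x0) \<bullet> v\<bar>"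
        by (simp add: F'_def abs_mult)
      also have "\<dots> \<le> 4 * r\<^sup>2 * (r * norm v)"
      proof (intro mult_mono)
        show "\<bar>(x - x0) \<bullet> v\<bar> \<le> r * norm v"
          using Cauchy_Schwarz_ineq2[of "x - x0" v] mult_right_mono[OF nx norm_ge_zero[of v]] by linarith
      qed auto
      also have "\<dots> = L * (b * norm v)" using b(1) by (simp add: L_def power2_eq_square power3_eq_cube)
      also have "\<dots> \<le> L * riem_norm g c q v" using b(2)[OF x(1)] x(2) L by simp
      finally show ?thesis .
    qed
    ultimately show ?thesis using c(1) q by blast
  next
    case False
    obtain c' where c': "c' \<in> A" "q \<in> fst c'" using chart_at[OF q] .
    let ?U = "snd c' ` ((topspace X - K) \<inter> fst c')"
    have "open ?U" using open_chart_image[OF c'(1)] K by blast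
    moreover have "snd c' q \<in> ?U" using q False c' by blast
    moreover have "(F \<circ> chart_inv c') x = 0" if "x \<in> ?U" for x
    proof -
      obtain q' where q': "x = snd c' q'" "q' \<notin> K" "q' \<in> fst c'" using \<open>x \<in> ?U\<close> by blast
      have "\<not> (q' \<in> fst c \<and> dist x0 (snd c q') < r)"
      proof
        assume in_ball: "q' \<in> fst c \<and> dist x0 (snd c q') < r"
        then have "chart_inv c (snd c q') \<in> K" unfolding K_def by (intro imageI) simp
        then show False using q'(2) chart_inv_chart[OF c(1)] in_ball by simp
      qed
      then have "F q' = 0" by (intro F_zero) (simp add: not_less)
      then show ?thesis using chart_inv_chart[OF c'(1) q'(3)] q'(1) by simp
    qed
    ultimately have "((F \<circ> chart_inv c') has_derivative (\<lambda>v. 0)) (at (snd c' q))"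
      by - (rule has_derivative_transform_within_open[where f = "\<lambda>_. 0" and s = ?U], simp_all)
    then show ?thesis using c' L riem_norm_nonneg[OF c']
      by (intro bexI[of _ c'] exI[of _ "\<lambda>v. 0"]) auto
  qed
  have "q \<in> fst c \<and> dist (snd c p) (snd c q) < r"
    if pq: "curve_of_length p q l" and l: "l < r ^ 4 / L" for q l
  proof (rule ccontr)
    assume "\<not> ?thesis"
    then have "F q = 0" using F_zero[of q] unfolding x0_def by linarith
    moreover have "F p = r ^ 4" using c(2) r(1) by (simp add: F_def \<phi>_def x0_def)
    moreover have "\<bar>F q - F p\<bar> \<le> L * l"
      using pq arc_length_lipschitz[OF _ less_imp_le[OF L] deriv] unfolding curve_of_length_def by blast
    ultimately have "r ^ 4 \<le> L * l" by simp
    then show False using l L by (simp add: field_simps)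
  qed
  then show ?thesis using r L by (intro exI[of _ "r ^ 4 / L"]) auto
qed

text \<open>The curve is the preimage under the chart of the straight segment in coordinates.\<close>

lemma segment_curve:
  assumes c: "c \<in> A" and seg: "closed_segment x y \<subseteq> chart_range c"
    and bound: "\<And>z. z \<in> closed_segment x y \<Longrightarrow> riem_norm g c (chart_inv c z) (y - x) \<le> \<beta>"
  shows "\<exists>l\<le>\<beta>. curve_of_length (chart_inv c x) (chart_inv c y) l"
proof -
  define z where "z t = x + t *\<^sub>R (y - x)" for t :: real
  define \<gamma> where "\<gamma> t = chart_inv c (z t)" for t
  have z_seg: "z t \<in> closed_segment x y" if "t \<in> {0..1}" for t
    using that by (auto simp: z_def closed_segment_def algebra_simps intro!: exI[of _ t])
  then have zR: "z t \<in> chart_range c" if "t \<in> {0..1}" for t using that seg by blast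
  have contz: "continuous_on T z" for T unfolding z_def by (intro continuous_intros)
  have dz: "(z has_vector_derivative (y - x)) (at t within T)" for t T
    unfolding z_def by (auto intro!: derivative_eq_intros)
  have C1: "C1_curve_on X A 0 1 \<gamma>"
    unfolding C1_curve_on_def
  proof (intro conjI ballI)
    have "continuous_map (top_of_set {0..1}) (top_of_set (chart_range c)) z"
      using contz zR by (auto simp: continuous_map_in_subtopology)
    from continuous_map_compose[OF this chart_inv_continuous[OF c]]
    show "continuous_map (top_of_set {0..1}) X \<gamma>" by (simp add: o_def \<gamma>_def[abs_def])
    fix c' assume c': "c' \<in> A"
    let ?T = "{t \<in> {0..1}. \<gamma> t \<in> fst c'}" and ?S = "snd c ` (fst c \<inter> fst c')"
    define D where "D t = frechet_derivative (transition c c') (at (z t)) (y - x)" for t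
    have zS: "z t \<in> ?S" if "t \<in> ?T" for t
      using that chart_inv_in[OF zR, of t] chart_chart_inv[OF zR, of t]
      unfolding \<gamma>_def by (metis (no_types, lifting) IntI imageI mem_Collect_eq)
    have "continuous_on ?T D" unfolding D_def
      by (rule continuous_on_compose2[OF Ck_on_1_continuous_frechet[OF transition_Ck1[OF c c']] contz])
         (use zS in blast)
    moreover have "((snd c' \<circ> \<gamma>) has_vector_derivative D t) (at t within {0..1})"
      if t: "t \<in> {0..1}" "\<gamma> t \<in> fst c'" for t
    proof -
      have tS: "z t \<in> ?S" using zS t by simp
      interpret T: linear "frechet_derivative (transition c c') (at (z t))"
        using Ck_on_1_linear[OF transition_Ck1[OF c c'] tS] .
      have "((\<lambda>s. transition c c' (z s)) has_derivative
          (\<lambda>h. frechet_derivative (transition c c') (at (z t)) (h *\<^sub>R (y - x)))) (at t within {0..1})"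
        by (rule has_derivative_compose[OF dz[unfolded has_vector_derivative_def] Ck_on_1_D[OF transition_Ck1[OF c c'] tS]])
      then have "((\<lambda>s. transition c c' (z s)) has_vector_derivative D t) (at t within {0..1})"
        by (simp add: has_vector_derivative_def T.scale D_def)
      then show ?thesis
        by (simp add: \<gamma>_def[abs_def] transition_def o_def)
    qed
    ultimately show "\<exists>D. continuous_on ?T D \<and> (\<forall>t\<in>{0..1}. \<gamma> t \<in> fst c' \<longrightarrow>
        ((snd c' \<circ> \<gamma>) has_vector_derivative D t) (at t within {0..1}))" by blast
  qed
  define f where "f t = riem_norm g c (chart_inv c (z t)) (y - x)" for t
  have "continuous_on {0..1} f" unfolding f_def
    using zR by (intro riem_norm_continuous[OF c contz]) auto
  then have f: "(f has_integral integral {0..1} f) {0..1}"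
    using integrable_continuous_interval integrable_integral by blast
  have speed: "curve_speed A g \<gamma> t = f t" if t: "t \<in> {0<..<1}" for t
  proof -
    have tR: "z t \<in> chart_range c" using zR t by simp
    have "((snd c \<circ> \<gamma>) has_vector_derivative (y - x)) (at t)"
      by (rule has_vector_derivative_transform_within_open[OF dz open_greaterThanLessThan t])
         (use zR in \<open>simp add: \<gamma>_def\<close>)
    then show ?thesis
      using curve_speed_eq[OF C1 t c] chart_inv_in[OF tR] by (simp add: f_def \<gamma>_def)
  qed
  have "arc_length \<gamma> 0 1 (integral {0..1} f)"
    by (rule arc_length_C1I[OF _ C1 f speed]) auto
  then have "curve_of_length (chart_inv c x) (chart_inv c y) (integral {0..1} f)"
    unfolding curve_of_length_def by (intro exI[of _ \<gamma>] exI[of _ 0] exI[of _ 1]) (simp add: \<gamma>_def z_def)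
  moreover have "integral {0..1} f \<le> \<beta>"
  proof (rule has_integral_le[OF f])
    show "((\<lambda>t::real. \<beta>) has_integral \<beta>) {0..1}" using has_integral_const_real[of \<beta> 0 1] by simp
    show "f t \<le> \<beta>" if "t \<in> {0..1}" for t using bound[OF z_seg[OF that]] by (simp add: f_def)
  qed
  ultimately show ?thesis by blast
qed

lemma chart_cball:
  assumes "c \<in> A" "p \<in> fst c" "open U" "snd c p \<in> U"
  obtains r where "r > 0" "cball (snd c p) r \<subseteq> chart_range c \<inter> U"
proof -
  have "open (chart_range c \<inter> U)" using chart_range_open[OF assms(1)] assms(3) by blast
  then show ?thesis using open_contains_cball[of "chart_range c \<inter> U"] that chart_in_range[OF assms(2)] assms(4) by blast
qed

lemma short_curves_in_chart:
  assumes c: "c \<in> A" and K: "cball x0 r \<subseteq> chart_range c"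
  shows "\<exists>B>0. \<forall>x\<in>cball x0 r. \<forall>y\<in>cball x0 r. \<exists>l\<le>B * dist x y. curve_of_length (chart_inv c x) (chart_inv c y) l"
proof -
  obtain B where B: "B > 0" "\<And>x v. x \<in> cball x0 r \<Longrightarrow> riem_norm g c (chart_inv c x) v \<le> B * norm v"
    using chart_norm_bounds[OF c compact_cball K] by meson
  have "\<exists>l\<le>B * dist x y. curve_of_length (chart_inv c x) (chart_inv c y) l"
    if "x \<in> cball x0 r" "y \<in> cball x0 r" for x y
  proof (rule segment_curve[OF c])
    have sub: "closed_segment x y \<subseteq> cball x0 r"
      using that by (intro closed_segment_subset) auto
    then show "closed_segment x y \<subseteq> chart_range c" using K by blast
    show "riem_norm g c (chart_inv c z) (y - x) \<le> B * dist x y" if "z \<in> closed_segment x y" for z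
      using B(2)[of z "y - x"] sub that by (auto simp: dist_norm norm_minus_commute)
  qed
  then show ?thesis using B(1) by blast
qed

lemma curve_of_length_refl:
  assumes "p \<in> topspace X" shows "curve_of_length p p 0"
proof -
  obtain c where c: "c \<in> A" "p \<in> fst c" using chart_at[OF assms] .
  have "\<exists>l\<le>0. curve_of_length (chart_inv c (snd c p)) (chart_inv c (snd c p)) l"
    using riem_norm_scale[OF c, of 0 0] chart_in_range[OF c(2)] c
    by (intro segment_curve[OF c(1)]) auto
  then obtain l where "l \<le> 0" "curve_of_length p p l" using c by auto
  then show ?thesis using curve_of_length_nonneg[of p p l] by (metis order_antisym)
qed

end

section \<open>The Riemannian distance\<close>

locale connected_riemannian_manifold = riemannian_manifold +
  assumes connected: "connected_space X"
begin

text \<open>The set of points that can be reached from \<open>p\<close> is open and closed, since each point is joined to all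
  points of a coordinate ball around it.\<close>

lemma curve_exists:
  assumes p: "p \<in> topspace X" and q: "q \<in> topspace X"
  shows "\<exists>l. curve_of_length p q l"
proof -
  have nbhd: "\<exists>U. openin X U \<and> x \<in> U \<and> (\<forall>y\<in>U. \<exists>l. curve_of_length x y l)" if x: "x \<in> topspace X" for x
  proof -
    obtain c where c: "c \<in> A" "x \<in> fst c" using chart_at[OF x] .
    obtain r where r: "r > 0" "cball (snd c x) r \<subseteq> chart_range c \<inter> UNIV"
      using chart_cball[OF c open_UNIV] by blast
    obtain B where B: "\<forall>y\<in>cball (snd c x) r. \<forall>z\<in>cball (snd c x) r. \<exists>l\<le>B * dist y z. curve_of_length (chart_inv c y) (chart_inv c z) l"
      using short_curves_in_chart[OF c(1)] r(2) by (metis Int_UNIV_right)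
    let ?U = "{y \<in> fst c. snd c y \<in> ball (snd c x) r}"
    have "\<exists>l. curve_of_length x y l" if "y \<in> ?U" for y
    proof -
      have "snd c y \<in> cball (snd c x) r" "snd c x \<in> cball (snd c x) r" using that r by auto
      then show ?thesis using B chart_inv_chart[OF c] chart_inv_chart[OF c(1), of y] that by fastforce
    qed
    then show ?thesis using openin_chart_vimage[OF c(1) open_ball] c r(1)
      by (intro exI[of _ ?U]) auto
  qed
  define S where "S = {x \<in> topspace X. \<exists>l. curve_of_length p x l}"
  have "openin X S"
  proof (subst openin_subopen, intro ballI)
    fix x assume "x \<in> S"
    then obtain U where U: "openin X U" "x \<in> U" "\<forall>y\<in>U. \<exists>l. curve_of_length x y l"
      using nbhd[of x] S_def by blast
    moreover have "U \<subseteq> S" using U \<open>x \<in> S\<close> curve_of_length_trans openin_subset[OF U(1)] unfolding S_def by blast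
    ultimately show "\<exists>T. openin X T \<and> x \<in> T \<and> T \<subseteq> S" by blast
  qed
  moreover have "openin X (topspace X - S)"
  proof (subst openin_subopen, intro ballI)
    fix x assume x: "x \<in> topspace X - S"
    then obtain U where U: "openin X U" "x \<in> U" "\<forall>y\<in>U. \<exists>l. curve_of_length x y l"
      using nbhd[of x] by blast
    moreover have "U \<subseteq> topspace X - S"
      using U x curve_of_length_trans curve_of_length_sym openin_subset[OF U(1)] unfolding S_def by blast
    ultimately show "\<exists>T. openin X T \<and> x \<in> T \<and> T \<subseteq> topspace X - S" by blast
  qed
  then have "closedin X S" unfolding closedin_def S_def by blast
  ultimately have "S = {} \<or> S = topspace X" using connected unfolding connected_space_clopen_in by blast
  moreover have "p \<in> S" using curve_of_length_refl[OF p] p S_def by blast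
  ultimately show ?thesis using q S_def by blast
qed

abbreviation rdist :: "'a \<Rightarrow> 'a \<Rightarrow> real" where "rdist \<equiv> riem_dist X A g"

lemma rdist_eq:
  assumes "p \<in> topspace X" "q \<in> topspace X"
  shows "rdist p q = Inf {l. curve_of_length p q l}"
proof -
  have "{curve_length A g \<gamma> |\<gamma>. piecewise_C1_curve X A \<gamma> \<and> \<gamma> 0 = p \<and> \<gamma> 1 = q} = {l. curve_of_length p q l}"
    unfolding curve_of_length_iff by blast
  then show ?thesis using assms unfolding riem_dist_def by simp
qed

lemma rdist_le: "curve_of_length p q l \<Longrightarrow> rdist p q \<le> l"
proof -
  assume l: "curve_of_length p q l"
  have "bdd_below {l. curve_of_length p q l}"
    using curve_of_length_nonneg by (auto simp: bdd_below_def)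
  then show ?thesis using l rdist_eq curve_in_space[OF l] by (simp add: cInf_lower)
qed

lemma rdist_less:
  assumes "p \<in> topspace X" "q \<in> topspace X" "rdist p q < e"
  obtains l where "curve_of_length p q l" "l < e"
proof -
  have "{l. curve_of_length p q l} \<noteq> {}" using curve_exists[OF assms(1,2)] by blast
  then show ?thesis using cInf_lessD[of "{l. curve_of_length p q l}" e] assms rdist_eq that by auto
qed

lemma rdist_nonneg: "0 \<le> rdist p q"
proof (cases "p \<in> topspace X \<and> q \<in> topspace X")
  case True
  then have "{l. curve_of_length p q l} \<noteq> {}" using curve_exists by blast
  then have "0 \<le> Inf {l. curve_of_length p q l}"
    using curve_of_length_nonneg by (intro cInf_greatest) auto
  then show ?thesis using True by (simp add: rdist_eq)
next
  case False
  then show ?thesis by (auto simp: riem_dist_def)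
qed

lemma rdist_small_in_chart:
  assumes c: "c \<in> A" "p \<in> fst c" and r: "r > 0" "cball (snd c p) r \<subseteq> chart_range c"
  shows "\<exists>\<delta>>0. \<forall>q\<in>topspace X. rdist p q < \<delta> \<longrightarrow> q \<in> fst c \<and> dist (snd c p) (snd c q) < r"
proof -
  have p: "p \<in> topspace X" using c chart_subset by blast
  obtain \<delta> where \<delta>: "\<delta> > 0" "\<And>q l. curve_of_length p q l \<Longrightarrow> l < \<delta> \<Longrightarrow>
      q \<in> fst c \<and> dist (snd c p) (snd c q) < r"
    using short_curves_stay_in_chart[OF assms] by blast
  have "q \<in> fst c \<and> dist (snd c p) (snd c q) < r" if "q \<in> topspace X" "rdist p q < \<delta>" for q
    using rdist_less[OF p that] \<delta>(2) by metis
  then show ?thesis using \<delta>(1) by blast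
qed

sublocale Metric_space "topspace X" rdist
proof
  fix p q r
  show "0 \<le> rdist p q" by (rule rdist_nonneg)
  have "{l. curve_of_length p q l} = {l. curve_of_length q p l}" by (auto intro: curve_of_length_sym)
  then show "rdist p q = rdist q p"
  proof (cases "p \<in> topspace X \<and> q \<in> topspace X")
    case True
    then show ?thesis using rdist_eq[of p q] rdist_eq[of q p] \<open>_ = {l. curve_of_length q p l}\<close> by simp
  next
    case False
    then show ?thesis by (auto simp: riem_dist_def)
  qed
  assume p: "p \<in> topspace X" and q: "q \<in> topspace X"
  show "rdist p q = 0 \<longleftrightarrow> p = q"
  proof
    assume eq: "rdist p q = 0"
    obtain c where c: "c \<in> A" "p \<in> fst c" using chart_at[OF p] .
    show "p = q"
    proof (rule ccontr)
      assume ne: "p \<noteq> q"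
      \<comment> \<open>a coordinate ball around \<open>p\<close> that misses \<open>q\<close>; if \<open>q\<close> is off the chart, any ball will do\<close>
      let ?U = "if q \<in> fst c then - {snd c q} else UNIV"
      have "snd c p \<in> ?U" using ne chart_inj[OF c(1)] c by (auto simp: inj_on_def)
      moreover have "open ?U" by auto
      ultimately obtain r where r: "r > 0" "cball (snd c p) r \<subseteq> chart_range c \<inter> ?U"
        using chart_cball[OF c] by blast
      then have "q \<in> fst c \<and> dist (snd c p) (snd c q) < r"
        using rdist_small_in_chart[OF c, of r] eq q by auto
      then have "snd c q \<in> ?U" using r(2) by auto
      then show False using \<open>q \<in> fst c \<and> _\<close> by simp
    qed
  next
    assume "p = q"
    then show "rdist p q = 0"
      using rdist_le[OF curve_of_length_refl[OF p]] rdist_nonneg[of p p] by simp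
  qed
  assume r: "r \<in> topspace X"
  show "rdist p r \<le> rdist p q + rdist q r"
  proof (rule field_le_epsilon)
    fix e :: real assume "e > 0"
    then obtain l l' where "curve_of_length p q l" "l < rdist p q + e / 2"
        "curve_of_length q r l'" "l' < rdist q r + e / 2"
      using rdist_less[OF p q, of "rdist p q + e / 2"] rdist_less[OF q r, of "rdist q r + e / 2"]
      by (metis half_gt_zero less_add_same_cancel1)
    then show "rdist p r \<le> rdist p q + rdist q r + e"
      using rdist_le[OF curve_of_length_trans] by fastforce
  qed
qed

lemma mtopology_eq: "mtopology = X"
proof (rule topology_eq[THEN iffD2], intro allI iffI)
  fix U assume U: "openin mtopology U"
  show "openin X U"
  proof (subst openin_subopen, intro ballI)
    fix p assume p: "p \<in> U"
    then obtain e where e: "e > 0" "mball p e \<subseteq> U" and pX: "p \<in> topspace X"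
      using U unfolding openin_mtopology by blast
    obtain c where c: "c \<in> A" "p \<in> fst c" using chart_at[OF pX] .
    obtain r where r: "r > 0" "cball (snd c p) r \<subseteq> chart_range c"
      using chart_cball[OF c open_UNIV] by auto
    obtain B where B: "B > 0" "\<And>x y. x \<in> cball (snd c p) r \<Longrightarrow> y \<in> cball (snd c p) r \<Longrightarrow>
        \<exists>l\<le>B * dist x y. curve_of_length (chart_inv c x) (chart_inv c y) l"
      using short_curves_in_chart[OF c(1) r(2)] by blast
    \<comment> \<open>radius of a coordinate ball that the upper bound on lengths sends into \<open>mball p e\<close>\<close>
    define s where "s = min r (e / B)"
    have s: "s > 0" "s \<le> r" "B * s \<le> e" using r e B by (auto simp: s_def min_def field_simps)
    let ?V = "{q \<in> fst c. snd c q \<in> ball (snd c p) s}"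
    have "?V \<subseteq> mball p e"
    proof
      fix q assume q: "q \<in> ?V"
      then have "snd c p \<in> cball (snd c p) r" "snd c q \<in> cball (snd c p) r" using s r by auto
      then obtain l where l: "l \<le> B * dist (snd c p) (snd c q)"
          "curve_of_length (chart_inv c (snd c p)) (chart_inv c (snd c q)) l"
        using B(2) by blast
      then have "curve_of_length p q l" using c q by simp
      moreover have "B * dist (snd c p) (snd c q) < B * s" using q B(1) by simp
      ultimately have "rdist p q < e" using rdist_le[of p q l] l(1) s(3) by linarith
      then show "q \<in> mball p e" using pX q chart_subset[OF c(1)] by auto
    qed
    moreover have "openin X ?V" by (rule openin_chart_vimage[OF c(1) open_ball])
    moreover have "p \<in> ?V" using c s by simp
    ultimately show "\<exists>T. openin X T \<and> p \<in> T \<and> T \<subseteq> U" using e(2) by blast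
  qed
next
  fix U assume U: "openin X U"
  show "openin mtopology U"
    unfolding openin_mtopology
  proof (intro conjI allI impI)
    show "U \<subseteq> topspace X" using openin_subset[OF U] .
    fix p assume p: "p \<in> U"
    then obtain c where c: "c \<in> A" "p \<in> fst c" using chart_at openin_subset[OF U] by blast
    have "snd c p \<in> snd c ` (U \<inter> fst c)" using p c by blast
    then obtain r where r: "r > 0" "cball (snd c p) r \<subseteq> chart_range c \<inter> snd c ` (U \<inter> fst c)"
      using chart_cball[OF c open_chart_image[OF c(1) U]] by blast
    then obtain \<delta> where \<delta>: "\<delta> > 0" "\<And>q. q \<in> topspace X \<Longrightarrow> rdist p q < \<delta> \<Longrightarrow>
        q \<in> fst c \<and> dist (snd c p) (snd c q) < r"
      using rdist_small_in_chart[OF c, of r] by auto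
    have "mball p \<delta> \<subseteq> U"
    proof
      fix q assume "q \<in> mball p \<delta>"
      then have q: "q \<in> fst c" "snd c q \<in> cball (snd c p) r" using \<delta>(2)[of q] by auto
      then obtain q' where "q' \<in> U" "q' \<in> fst c" "snd c q' = snd c q" using r(2) by auto
      then show "q \<in> U" using inj_onD[OF chart_inj[OF c(1)]] q(1) by metis
    qed
    then show "\<exists>r>0. mball p r \<subseteq> U" using \<delta>(1) by blast
  qed
qed

text \<open>Cut an almost shortest curve at the point where its length, which depends continuously on the
  parameter, has grown to a value between \<open>l - s\<close> and \<open>r\<close>.\<close>

lemma riemannian_length_property: length_property
  unfolding length_property_def
proof (intro ballI allI impI)
  fix x y r s assume x: "x \<in> topspace X" and y: "y \<in> topspace X" and r: "r > (0::real)" and s: "s > (0::real)"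
    and d: "rdist x y < r + s"
  obtain l where l: "curve_of_length x y l" "l < r + s" using rdist_less[OF x y d] .
  show "\<exists>z\<in>topspace X. rdist x z < r \<and> rdist z y < s"
  proof (cases "l < s")
    case True
    then show ?thesis using x r rdist_le[OF l(1)] by (intro bexI[of _ x]) auto
  next
    case False
    obtain \<gamma> a b where \<gamma>: "arc_length \<gamma> a b l" "\<gamma> a = x" "\<gamma> b = y"
      using l(1) unfolding curve_of_length_def by blast
    have ab: "a < b" using arc_length_less[OF \<gamma>(1)] .
    let ?I = "\<lambda>t. integral {a..t} (curve_speed A g \<gamma>)"
    note int = arc_length_has_integral[OF \<gamma>(1)]
    \<comment> \<open>the midpoint of the admissible interval; it lies strictly between \<open>0\<close> and \<open>l\<close>\<close>
    define m where "m = ((l - s) + min r l) / 2"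
    have m: "l - s < m" "m < r" "0 < m" "m < l"
      using False r s l(2) by (auto simp: m_def min_def)
    have "continuous_on {a..b} ?I"
      using int by (intro indefinite_integral_continuous_1) blast
    moreover have "?I a = 0" "?I b = l" using integral_unique[OF int] by auto
    ultimately obtain t where t: "a \<le> t" "t \<le> b" "?I t = m"
      using IVT'[of ?I a m b] m ab by auto
    then have "a < t" "t < b" using m \<open>?I a = 0\<close> \<open>?I b = l\<close> by (metis less_irrefl less_le)+
    then obtain l1 l2 where split: "arc_length \<gamma> a t l1" "arc_length \<gamma> t b l2" "l = l1 + l2"
      using arc_length_split[OF \<gamma>(1)] by blast
    have "l1 = m" using integral_unique[OF arc_length_has_integral[OF split(1)]] t(3) by simp
    have "curve_of_length x (\<gamma> t) l1" "curve_of_length (\<gamma> t) y l2"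
      using split \<gamma> unfolding curve_of_length_def by blast+
    then have "rdist x (\<gamma> t) < r" "rdist (\<gamma> t) y < s"
      using rdist_le m \<open>l1 = m\<close> split(3) by fastforce+
    then show ?thesis using arc_length_in_space[OF \<gamma>(1)] t by force
  qed
qed

lemma riemannian_locally_compact: locally_compact_metric
  unfolding locally_compact_metric_def
proof
  fix p assume p: "p \<in> topspace X"
  obtain c where c: "c \<in> A" "p \<in> fst c" using chart_at[OF p] .
  obtain r where r: "r > 0" "cball (snd c p) r \<subseteq> chart_range c"
    using chart_cball[OF c open_UNIV] by auto
  then obtain \<delta> where \<delta>: "\<delta> > 0" "\<And>q. q \<in> topspace X \<Longrightarrow> rdist p q < \<delta> \<Longrightarrow>
      q \<in> fst c \<and> dist (snd c p) (snd c q) < r"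
    using rdist_small_in_chart[OF c] by blast
  have "mcball p (\<delta> / 2) \<subseteq> chart_inv c ` cball (snd c p) r"
  proof
    fix q assume "q \<in> mcball p (\<delta> / 2)"
    then have "q \<in> fst c" "snd c q \<in> cball (snd c p) r" using \<delta>(1) \<delta>(2)[of q] by auto
    then show "q \<in> chart_inv c ` cball (snd c p) r"
      using chart_inv_chart[OF c(1), of q] by (metis imageI)
  qed
  moreover have "compactin mtopology (chart_inv c ` cball (snd c p) r)"
    using compactin_chart_inv_image[OF c(1) compact_cball r(2)] mtopology_eq by simp
  ultimately have "compactin mtopology (mcball p (\<delta> / 2))"
    using closed_compactin closedin_mcball by blast
  then show "\<exists>r>0. compactin mtopology (mcball p r)" using \<delta>(1) half_gt_zero by blast
qed

lemma path_component_of_arc: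
  "arc_length \<gamma> a b l \<Longrightarrow> path_component_of X (\<gamma> a) (\<gamma> b)"
proof (induction rule: arc_length.induct)
  case (C1_arc a b)
  let ?h = "\<lambda>t. (b - a) * t + a"
  have "?h t \<in> {a..b}" if "t \<in> {0..1}" for t
  proof -
    have "0 \<le> (b - a) * t" "(b - a) * t \<le> (b - a) * 1"
      using that C1_arc(1) by (auto intro!: mult_left_mono)
    then show ?thesis by auto
  qed
  then have "continuous_map (top_of_set {0..1}) (top_of_set {a..b}) ?h"
    by (auto simp: continuous_map_in_subtopology intro!: continuous_intros)
  then have "pathin X (\<gamma> \<circ> ?h)"
    unfolding pathin_def using C1_arc(2) C1_curve_on_def continuous_map_compose by blast
  then show ?case unfolding path_component_of_def by (intro exI[of _ "\<gamma> \<circ> ?h"]) auto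
next
  case (join a b l c l')
  show ?case by (rule path_component_of_trans[OF join.IH])
qed

lemma riemannian_path_connected: "path_connected_space X"
  unfolding path_connected_space_iff_path_component
proof (intro ballI)
  fix p q assume "p \<in> topspace X" "q \<in> topspace X"
  then obtain \<gamma> a b l where "arc_length \<gamma> a b l" "\<gamma> a = p" "\<gamma> b = q"
    using curve_exists unfolding curve_of_length_def by meson
  then show "path_component_of X p q" using path_component_of_arc by metis
qed

end

section \<open>Pushing along the gradient\<close>

context riemannian_manifold
begin

text \<open>The map \<open>w \<mapsto> g c p w _\<close> into the dual space is injective because \<open>g\<close> is positive definite, hence
  surjective. The sum \<open>T\<close> below is this map, with functionals represented by their values on the basis.\<close>

lemma gradient_unique_exists:
  fixes f :: "'b \<Rightarrow> real"
  assumes c: "c \<in> A" "p \<in> fst c" and f: "linear f"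
  shows "\<exists>!w. \<forall>v. g c p w v = f v"
proof -
  note bil = g_bilinear[OF c]
  define T where "T w = (\<Sum>j\<in>Basis. g c p w j *\<^sub>R j)" for w
  have T_inner: "T w \<bullet> i = g c p w i" if "i \<in> Basis" for w i
    unfolding T_def using that by simp
  have "linear T"
    by (rule linearI) (simp_all add: T_def bilinear_ladd[OF bil] bilinear_lmul[OF bil]
        scaleR_add_left sum.distrib scaleR_sum_right)
  have lin_g: "linear (g c p w)" for w using bil unfolding bilinear_def by blast
  have eq_on_basis: "(\<forall>v. g c p w v = h v) \<longleftrightarrow> (\<forall>i\<in>Basis. g c p w i = h i)" if "linear h" for w h
    using linear_eq_stdbasis[OF lin_g that] by metis
  have "inj T"
    unfolding linear_injective_0[OF \<open>linear T\<close>]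
  proof (intro allI impI)
    fix w assume "T w = 0"
    then have "\<forall>i\<in>Basis. g c p w i = 0" using T_inner by (metis inner_zero_left)
    then have "g c p w w = 0" using eq_on_basis[OF linear_zero] by blast
    then show "w = 0" using g_pos[OF c, of w] by force
  qed
  then have "surj T" using linear_injective_imp_surjective[OF \<open>linear T\<close>] by simp
  then obtain w where w: "T w = (\<Sum>j\<in>Basis. f j *\<^sub>R j)" by (metis surjD)
  have "g c p w i = f i" if "i \<in> Basis" for i
    using T_inner[OF that, of w] that by (simp add: w)
  then have "\<forall>v. g c p w v = f v" using eq_on_basis[OF f] by blast
  moreover have "w' = w" if "\<forall>v. g c p w' v = f v" for w'
  proof -
    have "g c p (w' - w) (w' - w) = 0"
      using that \<open>\<forall>v. g c p w v = f v\<close> by (simp add: bilinear_lsub[OF bil])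
    then show ?thesis using g_pos[OF c, of "w' - w"] by force
  qed
  ultimately show ?thesis by blast
qed

text \<open>A unit vector in whose direction \<open>u\<close> grows at unit rate; the gradient of a solution is one. In
  this form the passage from \<open>u\<close> to \<open>-u\<close> just reverses \<open>v\<close>.\<close>

definition unit_ascent :: "('a \<Rightarrow> real) \<Rightarrow> bool" where
  "unit_ascent u \<longleftrightarrow> C1_function A u \<and> (\<forall>c\<in>A. \<forall>p\<in>fst c. \<exists>v.
     riem_norm g c p v = 1 \<and> frechet_derivative (u \<circ> chart_inv c) (at (snd c p)) v = 1)"

lemma eikonal_unit_ascent:
  assumes "C1_eikonal_solution A g u" shows "unit_ascent u"
  unfolding unit_ascent_def
proof (intro conjI ballI)
  show C1: "C1_function A u" using assms unfolding C1_eikonal_solution_def by blast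
  fix c p assume c: "c \<in> A" "p \<in> fst c"
  let ?f = "frechet_derivative (u \<circ> chart_inv c) (at (snd c p))"
  have "linear ?f"
    using C1 c(1) unfolding C1_function_def by (intro Ck_on_1_linear[OF _ chart_in_range[OF c(2)]]) simp
  define w where "w = riem_gradient g c u p"
  have w: "g c p w v = ?f v" for v
    using theI'[OF gradient_unique_exists[OF c \<open>linear ?f\<close>]] unfolding w_def riem_gradient_def by blast
  have "riem_norm g c p w = 1"
    using assms c unfolding C1_eikonal_solution_def w_def by blast
  moreover from this have "?f w = 1" using w[of w] by (simp add: riem_norm_def)
  ultimately show "\<exists>v. riem_norm g c p v = 1 \<and> ?f v = 1" by blast
qed

lemma unit_ascent_uminus:
  assumes "unit_ascent u" shows "unit_ascent (\<lambda>x. - u x)"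
proof -
  have C1: "Ck_on 1 (chart_range c) (u \<circ> chart_inv c)" if "c \<in> A" for c
    using assms that unfolding unit_ascent_def C1_function_def by blast
  have comp: "(\<lambda>x. - u x) \<circ> chart_inv c = (\<lambda>x. - (u \<circ> chart_inv c) x)" for c by auto
  have deriv: "((\<lambda>x. - (u \<circ> chart_inv c) x) has_derivative
      (\<lambda>v. - frechet_derivative (u \<circ> chart_inv c) (at x) v)) (at x)" if "c \<in> A" "x \<in> chart_range c" for c x
    using Ck_on_1_D[OF C1[OF that(1)] that(2)] by (rule has_derivative_minus)
  then have D: "frechet_derivative (\<lambda>x. - (u \<circ> chart_inv c) x) (at x) =
      (\<lambda>v. - frechet_derivative (u \<circ> chart_inv c) (at x) v)" if "c \<in> A" "x \<in> chart_range c" for c x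
    using frechet_derivative_at[symmetric] that by blast
  have "Ck_on 1 (chart_range c) ((\<lambda>x. - u x) \<circ> chart_inv c)" if c: "c \<in> A" for c
    unfolding Ck_on_1_iff comp
  proof (intro conjI ballI allI)
    show "(\<lambda>x. - (u \<circ> chart_inv c) x) differentiable (at x)" if "x \<in> chart_range c" for x
      using deriv[OF c that] differentiable_def by blast
    show "continuous_on (chart_range c) (\<lambda>x. frechet_derivative (\<lambda>x. - (u \<circ> chart_inv c) x) (at x) v)" for v
      by (rule continuous_on_eq[OF continuous_on_minus[OF Ck_on_1_continuous_frechet[OF C1[OF c], of v]]])
         (simp only: D[OF c])
  qed
  moreover have "\<exists>v. riem_norm g c p v = 1 \<and>
      frechet_derivative ((\<lambda>x. - u x) \<circ> chart_inv c) (at (snd c p)) v = 1" if c: "c \<in> A" "p \<in> fst c" for c p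
  proof -
    obtain v where v: "riem_norm g c p v = 1" "frechet_derivative (u \<circ> chart_inv c) (at (snd c p)) v = 1"
      using assms c unfolding unit_ascent_def by blast
    have "linear (frechet_derivative (u \<circ> chart_inv c) (at (snd c p)))"
      using Ck_on_1_linear[OF C1[OF c(1)] chart_in_range[OF c(2)]] .
    then have "frechet_derivative ((\<lambda>x. - u x) \<circ> chart_inv c) (at (snd c p)) (- v) = 1"
      unfolding comp D[OF c(1) chart_in_range[OF c(2)]] using v(2) by (simp add: linear_neg)
    moreover have "riem_norm g c p (- v) = 1" using riem_norm_scale[OF c, of "- 1" v] v(1) by simp
    ultimately show ?thesis by blast
  qed
  ultimately show ?thesis unfolding unit_ascent_def C1_function_def by blast
qed

lemma C1_function_continuous: "C1_function A u \<Longrightarrow> continuous_map X euclideanreal u"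
  unfolding C1_function_def by (rule continuous_map_if_in_charts, rule Ck_on_1_continuous) simp

text \<open>The gradient at \<open>p\<close>, transported to the nearby points as a constant vector in the chart, still has
  slope close to \<open>1\<close> and norm close to \<open>1\<close> there, because \<open>u\<close> is \<open>C\<^sup>1\<close>.\<close>

lemma steep_chart_ball:
  assumes u: "unit_ascent u" and c: "c \<in> A" "p \<in> fst c"
  shows "\<exists>r v. r > 0 \<and> cball (snd c p) r \<subseteq> chart_range c \<and> (\<forall>x\<in>cball (snd c p) r.
     1 / 2 \<le> frechet_derivative (u \<circ> chart_inv c) (at x) v \<and> riem_norm g c (chart_inv c x) v \<le> 2)"
proof -
  let ?R = "chart_range c"
  have C1: "Ck_on 1 ?R (u \<circ> chart_inv c)" using u c unfolding unit_ascent_def C1_function_def by blast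
  obtain v where v: "riem_norm g c p v = 1" "frechet_derivative (u \<circ> chart_inv c) (at (snd c p)) v = 1"
    using u c unfolding unit_ascent_def by blast
  let ?h = "\<lambda>x. frechet_derivative (u \<circ> chart_inv c) (at x) v" and ?k = "\<lambda>x. riem_norm g c (chart_inv c x) v"
  have h: "continuous_on ?R ?h" by (rule Ck_on_1_continuous_frechet[OF C1])
  have k: "continuous_on ?R ?k" by (intro riem_norm_continuous[OF c(1)] continuous_intros) auto
  define U where "U = (?R \<inter> ?h -` {1/2<..}) \<inter> (?R \<inter> ?k -` {..<2})"
  have "open U" unfolding U_def
    by (intro open_Int continuous_open_preimage h k chart_range_open[OF c(1)] open_greaterThan open_lessThan)
  moreover have "snd c p \<in> U" unfolding U_def using chart_in_range[OF c(2)] c v by simp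
  ultimately obtain r where r: "r > 0" "cball (snd c p) r \<subseteq> ?R \<inter> U" using chart_cball[OF c] by blast
  have "1 / 2 \<le> ?h x \<and> ?k x \<le> 2" if "x \<in> cball (snd c p) r" for x
  proof -
    have "x \<in> U" using r(2) that by blast
    then show ?thesis by (simp add: U_def)
  qed
  then show ?thesis using r by (intro exI[of _ r] exI[of _ v]) auto
qed

end

context connected_riemannian_manifold
begin

lemma gain_along_segment:
  assumes u: "C1_function A u" and c: "c \<in> A" and R: "cball x0 r \<subseteq> chart_range c"
    and steep: "\<And>x. x \<in> cball x0 r \<Longrightarrow>
      1 / 2 \<le> frechet_derivative (u \<circ> chart_inv c) (at x) v \<and> riem_norm g c (chart_inv c x) v \<le> 2"
    and x: "x \<in> cball x0 r" and s: "0 \<le> s" "x + s *\<^sub>R v \<in> cball x0 r"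
  shows "s / 2 \<le> u (chart_inv c (x + s *\<^sub>R v)) - u (chart_inv c x)"
    and "rdist (chart_inv c x) (chart_inv c (x + s *\<^sub>R v)) \<le> 2 * s"
proof -
  have C1: "Ck_on 1 (chart_range c) (u \<circ> chart_inv c)" using u c unfolding C1_function_def by blast
  have seg: "closed_segment x (x + s *\<^sub>R v) \<subseteq> cball x0 r"
    using x s by (intro closed_segment_subset) auto
  have on_seg: "x + t *\<^sub>R v \<in> cball x0 r" if t: "0 \<le> t" "t \<le> s" for t
  proof (cases "s = 0")
    case True then show ?thesis using t x by simp
  next
    case False
    have "x + t *\<^sub>R v = (1 - t / s) *\<^sub>R x + (t / s) *\<^sub>R (x + s *\<^sub>R v)"
      using False by (simp add: algebra_simps)
    then have "x + t *\<^sub>R v \<in> closed_segment x (x + s *\<^sub>R v)"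
      unfolding closed_segment_def using t False by (auto intro!: exI[of _ "t / s"])
    then show ?thesis using seg by blast
  qed
  let ?f = "u \<circ> chart_inv c"
  define D where "D t h = frechet_derivative ?f (at (x + t *\<^sub>R v)) (h *\<^sub>R v)" for t h
  have der: "((\<lambda>t. ?f (x + t *\<^sub>R v)) has_derivative D t) (at t)" if "0 \<le> t" "t \<le> s" for t
  proof -
    have "((\<lambda>t. x + t *\<^sub>R v) has_derivative (\<lambda>h. h *\<^sub>R v)) (at t)"
      by (auto intro!: derivative_eq_intros)
    moreover have "(?f has_derivative frechet_derivative ?f (at (x + t *\<^sub>R v))) (at (x + t *\<^sub>R v))"
      using Ck_on_1_D[OF C1] on_seg[OF that] R by blast
    ultimately show ?thesis unfolding D_def by (rule has_derivative_compose)
  qed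
  show "s / 2 \<le> u (chart_inv c (x + s *\<^sub>R v)) - u (chart_inv c x)"
  proof (cases "s = 0")
    case False
    then have "0 < s" using s by simp
    have "continuous_on {0..s} (\<lambda>t. ?f (x + t *\<^sub>R v))"
      by (intro continuous_at_imp_continuous_on ballI has_derivative_continuous[OF der]) auto
    then obtain t where t: "0 < t" "t < s" "?f (x + s *\<^sub>R v) - ?f (x + 0 *\<^sub>R v) = D t (s - 0)"
      using mvt[OF \<open>0 < s\<close>, of "\<lambda>t. ?f (x + t *\<^sub>R v)" D] der by (metis less_imp_le)
    have tB: "x + t *\<^sub>R v \<in> cball x0 r" using on_seg t by simp
    have "linear (frechet_derivative ?f (at (x + t *\<^sub>R v)))"
      using Ck_on_1_linear[OF C1] tB R by blast
    then have "D t s = s * frechet_derivative ?f (at (x + t *\<^sub>R v)) v"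
      unfolding D_def by (simp add: linear_scale)
    also have "\<dots> \<ge> s * (1 / 2)" using steep[OF tB] \<open>0 < s\<close> by (intro mult_left_mono) auto
    finally show ?thesis using t(3) by simp
  qed simp
  have "\<exists>l\<le>2 * s. curve_of_length (chart_inv c x) (chart_inv c (x + s *\<^sub>R v)) l"
  proof (rule segment_curve[OF c])
    show "closed_segment x (x + s *\<^sub>R v) \<subseteq> chart_range c" using seg R by blast
    fix z assume "z \<in> closed_segment x (x + s *\<^sub>R v)"
    then have z: "z \<in> cball x0 r" using seg by blast
    then have "chart_inv c z \<in> fst c" using R by (intro chart_inv_in) blast
    then show "riem_norm g c (chart_inv c z) (x + s *\<^sub>R v - x) \<le> 2 * s"
      using riem_norm_scale[OF c, of "chart_inv c z" s v] steep[OF z] s(1)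
      by (simp add: mult.commute[of 2] mult_left_mono)
  qed
  then show "rdist (chart_inv c x) (chart_inv c (x + s *\<^sub>R v)) \<le> 2 * s"
    using rdist_le by fastforce
qed

text \<open>In the chart, move each point \<open>x\<close> of the ball by \<open>\<eta> x *\<^sub>R v\<close>, where \<open>\<eta>\<close> vanishes on the boundary of the
  ball, and leave all other points fixed. A displacement by \<open>s *\<^sub>R v\<close> has length at most \<open>2 * s\<close> and gains at
  least \<open>s / 2\<close>; this is the constant \<open>4\<close>.\<close>

lemma unit_ascent_locally_pushable:
  assumes u: "unit_ascent u" shows "locally_pushable u 4"
  unfolding locally_pushable_def
proof
  fix p assume "p \<in> topspace X"
  then obtain c where c: "c \<in> A" "p \<in> fst c" by (rule chart_at)
  have C1: "C1_function A u" using u unfolding unit_ascent_def by blast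
  obtain r v where r: "r > 0" "cball (snd c p) r \<subseteq> chart_range c"
    and steep: "\<And>x. x \<in> cball (snd c p) r \<Longrightarrow>
      1 / 2 \<le> frechet_derivative (u \<circ> chart_inv c) (at x) v \<and> riem_norm g c (chart_inv c x) v \<le> 2"
    using steep_chart_ball[OF u c] by blast
  define x0 where "x0 = snd c p"
  \<comment> \<open>the divisor \<open>1 + norm v\<close> keeps the image of the ball inside the ball\<close>
  define \<eta> where "\<eta> x = max 0 (r - dist x0 x) / (1 + norm v)" for x
  define push where "push q = chart_inv c (snd c q + \<eta> (snd c q) *\<^sub>R v)" for q
  define \<psi> where "\<psi> q = (if q \<in> fst c then push q else q)" for q
  note B = r(2)[folded x0_def] and steep = steep[folded x0_def]
  have nv: "1 + norm v > 0" using norm_ge_zero[of v] by linarith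
  have \<eta>_nonneg: "0 \<le> \<eta> x" for x unfolding \<eta>_def using nv by simp
  have \<eta>_zero: "\<eta> x = 0" if "r \<le> dist x0 x" for x using that unfolding \<eta>_def by simp
  have stays: "x + s *\<^sub>R v \<in> cball x0 r" if x: "x \<in> cball x0 r" and s: "0 \<le> s" "s \<le> \<eta> x" for x s
  proof -
    have "s * norm v \<le> \<eta> x * (1 + norm v)" using s nv by (intro mult_mono) auto
    also have "\<dots> = r - dist x0 x" using nv x by (simp add: \<eta>_def)
    finally have "norm (s *\<^sub>R v) \<le> r - dist x0 x" using s by simp
    moreover have "dist x0 (x + s *\<^sub>R v) \<le> dist x0 x + norm (s *\<^sub>R v)"
      using dist_triangle[of x0 "x + s *\<^sub>R v" x] by (simp add: dist_norm)
    ultimately show ?thesis by simp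
  qed
  have outside: "push q = q" if "q \<in> fst c" "r \<le> dist x0 (snd c q)" for q
    using \<eta>_zero[OF that(2)] that(1) c(1) by (simp add: push_def)
  have cont\<eta>: "continuous_on S \<eta>" for S
    unfolding \<eta>_def using nv by (intro continuous_intros) auto
  have maps_range: "x + \<eta> x *\<^sub>R v \<in> chart_range c" if "x \<in> chart_range c" for x
  proof (cases "r \<le> dist x0 x")
    case True
    then show ?thesis using \<eta>_zero that by simp
  next
    case False
    then show ?thesis using stays[of x "\<eta> x"] \<eta>_nonneg[of x] B by auto
  qed
  have "continuous_map (subtopology X (fst c)) X push"
  proof -
    have 1: "continuous_map (subtopology X (fst c)) (top_of_set (chart_range c)) (snd c)"
      using homeomorphic_imp_continuous_map[OF chart_homeomorphic[OF c(1)]] .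
    have "continuous_on (chart_range c) (\<lambda>x. x + \<eta> x *\<^sub>R v)" by (intro continuous_intros cont\<eta>)
    then have 2: "continuous_map (top_of_set (chart_range c)) (top_of_set (chart_range c)) (\<lambda>x. x + \<eta> x *\<^sub>R v)"
      using maps_range by (auto simp: continuous_map_in_subtopology)
    show ?thesis
      using continuous_map_compose[OF continuous_map_compose[OF 1 2] chart_inv_continuous[OF c(1)]]
      by (simp add: o_def push_def[abs_def])
  qed
  moreover have "closedin X (chart_inv c ` cball x0 r)"
    using compactin_imp_closedin[OF Hausdorff compactin_chart_inv_image[OF c(1) compact_cball B]] .
  ultimately have "continuous_map X X \<psi>"
  proof (intro pasting_lemma[where I = "{True, False}" and X = X and Y = X and g = \<psi>
        and T = "\<lambda>i. if i then fst c else topspace X - chart_inv c ` cball x0 r"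
        and f = "\<lambda>i. if i then push else (\<lambda>q. q)"])
    have off: "push q = q" if "q \<in> fst c" "q \<notin> chart_inv c ` cball x0 r" for q
    proof (rule outside[OF that(1)], rule ccontr)
      assume "\<not> r \<le> dist x0 (snd c q)"
      then have "chart_inv c (snd c q) \<in> chart_inv c ` cball x0 r" by (intro imageI) simp
      then show False using that c(1) by simp
    qed
    fix i j q
    assume ij: "i \<in> {True, False}" "j \<in> {True, False}"
      and q: "q \<in> topspace X \<inter> (if i then fst c else topspace X - chart_inv c ` cball x0 r) \<inter>
        (if j then fst c else topspace X - chart_inv c ` cball x0 r)"
    show "(if i then push else (\<lambda>q. q)) q = (if j then push else (\<lambda>q. q)) q"
      using q off[of q] by (cases i; cases j) auto
  next
    fix q assume q: "q \<in> topspace X"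
    have "chart_inv c ` cball x0 r \<subseteq> fst c"
      by (intro image_subsetI chart_inv_in subsetD[OF B])
    then have "q \<notin> chart_inv c ` cball x0 r" if "q \<notin> fst c" using that by blast
    then show "\<exists>j. j \<in> {True, False} \<and> q \<in> (if j then fst c else topspace X - chart_inv c ` cball x0 r) \<and>
        \<psi> q = (if j then push else (\<lambda>q. q)) q"
      using q by (intro exI[of _ "q \<in> fst c"]) (auto simp: \<psi>_def)
  qed (auto simp: chart_domain_open[OF c(1)] continuous_map_from_subtopology)
  moreover have "climbs u 4 q (\<psi> q)" if q: "q \<in> topspace X" for q
  proof (cases "q \<in> fst c \<and> dist x0 (snd c q) < r")
    case False
    then have "\<psi> q = q" using outside[of q] by (auto simp: \<psi>_def)
    then show ?thesis using climbs_refl q by simp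
  next
    case True
    define x where "x = snd c q"
    have x: "x \<in> cball x0 r" "chart_inv c x = q" using True c(1) by (auto simp: x_def)
    define S where "S = (\<lambda>s. chart_inv c (x + s *\<^sub>R v)) ` {0..\<eta> x}"
    have in_range: "x + s *\<^sub>R v \<in> chart_range c" if "s \<in> {0..\<eta> x}" for s using stays[OF x(1)] that B by auto
    have "continuous_map (top_of_set {0..\<eta> x}) (top_of_set (chart_range c)) (\<lambda>s. x + s *\<^sub>R v)"
      using in_range by (auto simp: continuous_map_in_subtopology intro!: continuous_intros)
    from continuous_map_compose[OF this chart_inv_continuous[OF c(1)]]
    have "continuous_map (top_of_set {0..\<eta> x}) X (\<lambda>s. chart_inv c (x + s *\<^sub>R v))" by (simp add: o_def)
    then have "connectedin X S"
      unfolding S_def by (rule connectedin_continuous_map_image) (simp add: connectedin_subtopology)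
    moreover have "q \<in> S" unfolding S_def using x(2) \<eta>_nonneg[of x] by (intro image_eqI[of _ _ 0]) auto
    moreover have "\<psi> q \<in> S"
      unfolding S_def using True \<eta>_nonneg[of x] by (intro image_eqI[of _ _ "\<eta> x"]) (auto simp: \<psi>_def push_def x_def)
    moreover have "rdist q y \<le> 4 * (u y - u q)" if y: "y \<in> S" for y
    proof -
      obtain s where s: "0 \<le> s" "s \<le> \<eta> x" "y = chart_inv c (x + s *\<^sub>R v)" using y unfolding S_def by auto
      show ?thesis
        using gain_along_segment[OF C1 c(1) B steep x(1) s(1) stays[OF x(1) s(1,2)]] x(2) s(3) by simp
    qed
    ultimately show ?thesis unfolding climbs_def mtopology_eq by blast
  qed
  ultimately have "pushes u 4 \<psi>" unfolding pushes_def mtopology_eq by blast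
  moreover have "u p < u (\<psi> p)"
  proof -
    have x0: "x0 \<in> cball x0 r" "chart_inv c x0 = p" using r c by (auto simp: x0_def)
    have "\<eta> x0 / 2 \<le> u (\<psi> p) - u p"
      using gain_along_segment(1)[OF C1 c(1) B steep x0(1) \<eta>_nonneg stays[OF x0(1) \<eta>_nonneg order_refl]] x0(2) c(2)
      by (simp add: \<psi>_def push_def x0_def)
    moreover have "\<eta> x0 > 0" using r(1) nv by (simp add: \<eta>_def)
    ultimately show ?thesis by linarith
  qed
  ultimately show "\<exists>\<psi>. pushes u 4 \<psi> \<and> u p < u (\<psi> p)" by blast
qed

end

section \<open>Ends of manifolds with eikonal solutions\<close>

theorem theorem4:
  fixes X :: "'a topology" and A :: "('a, 'b::euclidean_space) chart set"
  assumes "smooth_manifold X A"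
    and "connected_space X"
    and "\<not> compact_space X"
    and "infinite (ends_of X) \<or> card (ends_of X) \<ge> 3"
  shows "\<forall>g. complete_riemannian_metric X A g \<longrightarrow> \<not> (\<exists>u. C1_eikonal_solution A g u)"
proof (intro allI impI notI)
  fix g assume g: "complete_riemannian_metric X A g" and "\<exists>u. C1_eikonal_solution A g u"
  then obtain u where u: "C1_eikonal_solution A g u" by blast
  interpret smooth_manifold X A by fact
  interpret connected_riemannian_manifold X A g
    by unfold_locales (use g assms(2) in \<open>auto simp: complete_riemannian_metric_def\<close>)
  have asc: "unit_ascent u" using eikonal_unit_ascent[OF u] .
  have "mcomplete" using g unfolding complete_riemannian_metric_def by blast
  moreover have "continuous_map mtopology euclideanreal u"
    using asc C1_function_continuous mtopology_eq unfolding unit_ascent_def by simp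
  ultimately have "finite (ends_of mtopology) \<and> card (ends_of mtopology) \<le> 2"
    using at_most_two_ends[of 4 u] riemannian_locally_compact riemannian_length_property
      unit_ascent_locally_pushable[OF asc] unit_ascent_locally_pushable[OF unit_ascent_uminus[OF asc]]
      riemannian_path_connected mtopology_eq by simp
  then show False using assms(4) mtopology_eq by auto
qed

end
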